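(* Let $k$ be an algebraically closed field of characteristic $0$, let $R=k\langle x,y\rangle/(xy-yx-y^2)$, and let $n\geq 1$. For every $n$-dimensional representation $\rho_n: R\to M_n(k)$, the dimension over $k$ of the image algebra $\rho_n(R)$ does not exceed $n(n+2)/4$ if $n$ is even, and does not exceed $(n+1)^2/4$ if $n$ is odd. Moreover, this estimate is attained in the stratum $\mathcal{U}_{(n)}$ related to the full Jordan block $Y$, i.e. for each $n$ equality holds for some representation $\rho_n$ such that the Jordan normal form of $\rho_n(y)$ is a single Jordan block of size $n$.
   Context: Representations are unital $k$-algebra homomorphisms $R\to M_n(k)$; such a representation is given by a pair $(X,Y)=(\rho_n(x),\rho_n(y))$ of $n\times n$ matrices with $XY-YX=Y^2$, and $\rho_n(R)$ is the unital subalgebra of $M_n(k)$ generated by $X$ and $Y$. The matrix $Y$ is always nilpotent. $\mathcal{U}_{(n)}$ is the set of such pairs $(X,Y)$ for which the Jordan normal form of $Y$ is a single (nilpotent) Jordan block of size $n$. *)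

theory Defs
  imports
    "HOL-Library.Poly_Mapping"
    "HOL-Algebra.QuotRing"
    "HOL-Computational_Algebra.Polynomial"
    "Jordan_Normal_Form.Jordan_Normal_Form"
    "Jordan_Normal_Form.VS_Connect"
begin

section \<open>The free algebra on two generators\<close>

datatype letter = LX | LY

text \<open>
  The free monoid on the two generators, written additively: finitely supported functions
  on an additive monoid carry the convolution product, so that the functions
  \<open>word \<Rightarrow>\<^sub>0 'k\<close> are the monoid algebra of the free monoid, i.e. the free associative algebra
  \<open>k\<langle>x,y\<rangle>\<close>.
\<close>

datatype word = Word "letter list"

instantiation word :: monoid_add
begin

definition zero_word :: word where
  "0 = Word []"

fun plus_word :: "word \<Rightarrow> word \<Rightarrow> word" where
  "Word u + Word v = Word (u @ v)"

instance
proof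
  fix a b c :: word
  show "a + b + c = a + (b + c)" by (cases a; cases b; cases c) simp
  show "0 + a = a" by (cases a) (simp add: zero_word_def)
  show "a + 0 = a" by (cases a) (simp add: zero_word_def)
qed

end

type_synonym 'k free_alg = "word \<Rightarrow>\<^sub>0 'k"

definition gen :: "letter \<Rightarrow> 'k::field free_alg" where
  "gen l = Poly_Mapping.single (Word [l]) 1"

definition scalar :: "'k::field \<Rightarrow> 'k free_alg" where
  "scalar c = Poly_Mapping.single 0 c"


section \<open>The algebra \<open>R = k\<langle>x,y\<rangle>/(xy - yx - y\<^sup>2)\<close>\<close>

abbreviation free_ring :: "'k::field free_alg ring" where
  "free_ring \<equiv> class_ring"

definition rel_ideal :: "'k::field free_alg set" where
  "rel_ideal = genideal free_ring {gen LX * gen LY - gen LY * gen LX - gen LY * gen LY}"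

definition R_alg :: "'k::field free_alg set ring" where
  "R_alg = free_ring Quot rel_ideal"

definition R_class :: "'k::field free_alg \<Rightarrow> 'k free_alg set" where
  "R_class p = rel_ideal +>\<^bsub>free_ring\<^esub> p"

text \<open>
  The carrier of \<^const>\<open>class_ring\<close> is the whole type; the generated ideal is the two-sided one
  of \<^const>\<open>genideal\<close>, and it is a genuine ideal because the free algebra is a ring.
\<close>

lemma rel_ideal_ideal: "ideal (rel_ideal :: 'k::field free_alg set) free_ring"
  unfolding rel_ideal_def
  by (rule ring.genideal_ideal[OF class_ring.ring_axioms]) (simp add: class_ring_simps)

lemma R_alg_ring: "ring (R_alg :: 'k::field free_alg set ring)"
  unfolding R_alg_def by (rule ideal.quotient_is_ring[OF rel_ideal_ideal])


section \<open>Representations\<close>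

text \<open>
  A unital ring homomorphism that moreover sends the scalar \<open>c \<in> k\<close> of \<open>R\<close> to \<open>c\<close> times the
  identity matrix is the same as a unital \<open>k\<close>-algebra homomorphism; \<^const>\<open>Ring.ring_hom\<close> already
  demands preservation of the unit.
\<close>

definition representation :: "nat \<Rightarrow> ('k::field free_alg set \<Rightarrow> 'k mat) \<Rightarrow> bool" where
  "representation n \<rho> \<longleftrightarrow>
     \<rho> \<in> Ring.ring_hom R_alg (ring_mat TYPE('k) n ()) \<and>
     (\<forall>c. \<rho> (R_class (scalar c)) = c \<cdot>\<^sub>m 1\<^sub>m n)"

definition image_alg :: "('k::field free_alg set \<Rightarrow> 'k mat) \<Rightarrow> 'k mat set" where
  "image_alg \<rho> = \<rho> ` carrier R_alg"

definition image_dim :: "nat \<Rightarrow> ('k::field free_alg set \<Rightarrow> 'k mat) \<Rightarrow> nat" where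
  "image_dim n \<rho> =
     vectorspace.dim class_ring (module_mat TYPE('k) n n \<lparr>carrier := image_alg \<rho>\<rparr>)"

definition dim_bound :: "nat \<Rightarrow> rat" where
  "dim_bound n = (if even n then of_nat (n * (n + 2)) / 4 else of_nat ((n + 1)\<^sup>2) / 4)"

end

theory Submission
  imports Defs
begin

text \<open>
  A representation is a pair of matrices with \<open>XY - YX = Y\<^sup>2\<close>, and the image algebra is spanned by the words
  in \<open>X\<close> and \<open>Y\<close>, indeed by the monomials \<open>Y\<^sup>a X\<^sup>b\<close>.

  For the upper bound suppose first that \<open>X\<close> has a single eigenvalue; subtracting it changes neither the
  algebra nor the relation. The matrix \<open>Y\<close> is singular and its kernel is stable under \<open>X\<close>, which yields
  common eigenvectors (\<open>common_eigenvector\<close>), and so \<open>X\<close> and \<open>Y\<close> become strictly upper triangular in a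
  suitable basis. Fix a degree \<open>M\<close>. There are \<open>M (M + 1) / 2\<close> monomials of degree less than \<open>M\<close>, and all the
  others vanish below the \<open>M\<close>-th superdiagonal, where there is room for \<open>(n - M) (n - M + 1) / 2\<close>
  dimensions only. With \<open>M = n div 2\<close> the sum is \<open>(n + 1)\<^sup>2 div 4\<close>, which is the bound for either parity.
  Several eigenvalues of \<open>X\<close> are separated by a better choice of the triangular form (\<open>adapted_form\<close>), the
  argument is carried out for each of them (\<open>adapted_spanning_set\<close>), and the bound is superadditive
  (\<open>peak_superadditive\<close>).

  The bound is attained when \<open>Y\<close> is the Jordan block and \<open>X\<close> has entries only on the first superdiagonal.
  Then the algebra is graded by the superdiagonals, and each degree \<open>m\<close> is as large as the count above
  permits: it contains \<open>min (m + 1) (n - m)\<close> matrices whose entries form a triangular system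
  (\<open>diagonal_product_mem\<close>, \<open>diagonal_product_independent\<close>).
\<close>


section \<open>Common eigenvectors\<close>

definition jordan_plane_pair :: "nat \<Rightarrow> 'k::field mat \<Rightarrow> 'k mat \<Rightarrow> bool" where
  "jordan_plane_pair n X Y \<longleftrightarrow>
     X \<in> carrier_mat n n \<and> Y \<in> carrier_mat n n \<and> X * Y = Y * X + Y * Y"

definition mtrace :: "'k::comm_monoid_add mat \<Rightarrow> 'k" where
  "mtrace A = (\<Sum>i<dim_row A. A $$ (i, i))"

lemma mtrace_commute:
  fixes A B :: "'k::comm_semiring_0 mat"
  assumes "A \<in> carrier_mat n n" "B \<in> carrier_mat n n"
  shows "mtrace (A * B) = mtrace (B * A)"
proof -
  have "mtrace (A * B) = (\<Sum>i<n. \<Sum>j<n. A $$ (i, j) * B $$ (j, i))"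
    using assms by (auto simp: mtrace_def scalar_prod_def lessThan_atLeast0 intro!: sum.cong)
  also have "\<dots> = (\<Sum>j<n. \<Sum>i<n. B $$ (j, i) * A $$ (i, j))"
    by (subst sum.swap) (simp add: mult.commute)
  also have "\<dots> = mtrace (B * A)"
    using assms by (auto simp: mtrace_def scalar_prod_def lessThan_atLeast0 intro!: sum.cong)
  finally show ?thesis .
qed

text \<open>
  An inverse \<open>Z\<close> of \<open>Y\<close> would turn the relation, multiplied by \<open>Z\<close> on both sides, into
  \<open>ZX - XZ = 1\<close>; taking traces gives \<open>n = 0\<close> in the field. Together with the triangular form below
  this is where the nilpotency of \<open>Y\<close> comes from.
\<close>

lemma jordan_plane_pair_det:
  fixes X Y :: "'k::field_char_0 mat"
  assumes pair: "jordan_plane_pair n X Y" and n: "n > 0"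
  shows "det Y = 0"
proof (rule ccontr)
  assume "det Y \<noteq> 0"
  have c: "X \<in> carrier_mat n n" "Y \<in> carrier_mat n n" and rel: "X * Y = Y * X + Y * Y"
    using pair by (auto simp: jordan_plane_pair_def)
  interpret R: ring "ring_mat TYPE('k) n ()" by (rule ring_mat)
  from det_non_zero_imp_unit[OF c(2) \<open>det Y \<noteq> 0\<close>, of "()"]
  obtain Z where Z: "Z \<in> carrier_mat n n" "Z * Y = 1\<^sub>m n" "Y * Z = 1\<^sub>m n"
    by (auto simp: Units_def ring_mat_simps)
  have "Z * X = Z * X * (Y * Z)" using Z c by simp
  also have "\<dots> = Z * (X * Y) * Z" using Z(1) c by (simp add: assoc_mult_mat[of _ n n _ n _ n])
  also have "\<dots> = (Z * (Y * X) + Z * (Y * Y)) * Z" unfolding rel using Z(1) c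
    by (subst mult_add_distrib_mat[of _ n n _ n]) auto
  also have "Z * (Y * X) = X" using Z c by (simp flip: assoc_mult_mat[of Z n n Y n _ n])
  also have "Z * (Y * Y) = Y" using Z c by (simp flip: assoc_mult_mat[of Z n n Y n _ n])
  also have "(X + Y) * Z = X * Z + 1\<^sub>m n" using Z c by (simp add: add_mult_distrib_mat[of _ n n _ _ n])
  finally have "mtrace (Z * X) = mtrace (X * Z + 1\<^sub>m n)" by simp
  also have "\<dots> = mtrace (X * Z) + of_nat n" using Z c by (simp add: mtrace_def sum.distrib)
  finally show False using mtrace_commute[OF Z(1) c(1)] n by simp
qed

text \<open>\<open>poly_act X v p\<close> is the vector \<open>p(X) v\<close>.\<close>

definition poly_act :: "'k::field mat \<Rightarrow> 'k vec \<Rightarrow> 'k poly \<Rightarrow> 'k vec" where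
  "poly_act X v p = fold_coeffs (\<lambda>c w. c \<cdot>\<^sub>v v + X *\<^sub>v w) p (0\<^sub>v (dim_vec v))"

lemma poly_act_0: "poly_act X v 0 = 0\<^sub>v (dim_vec v)"
  by (simp add: poly_act_def)

lemma poly_act_pCons:
  fixes X :: "'k::field mat"
  assumes "X \<in> carrier_mat n n" "v \<in> carrier_vec n"
  shows "poly_act X v (pCons c p) = c \<cdot>\<^sub>v v + X *\<^sub>v poly_act X v p"
proof (cases "p = 0 \<and> c = 0")
  case True
  then show ?thesis using assms by (intro eq_vecI) (auto simp: poly_act_0 scalar_prod_def)
next
  case False
  then show ?thesis
    by (auto simp: poly_act_def)
qed

lemma poly_act_carrier:
  fixes X :: "'k::field mat"
  assumes "X \<in> carrier_mat n n" "v \<in> carrier_vec n"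
  shows "poly_act X v p \<in> carrier_vec n"
  by (induction p) (use assms in \<open>auto simp: poly_act_0 poly_act_pCons\<close>)

lemma poly_act_add:
  fixes X :: "'k::field mat"
  assumes c: "X \<in> carrier_mat n n" "v \<in> carrier_vec n"
  shows "poly_act X v (p + q) = poly_act X v p + poly_act X v q"
proof (induction p q rule: poly_induct2)
  case 0
  then show ?case using c by (simp add: poly_act_0)
next
  case (pCons a p b q)
  have "X *\<^sub>v (poly_act X v p + poly_act X v q) = X *\<^sub>v poly_act X v p + X *\<^sub>v poly_act X v q"
    using c poly_act_carrier[OF c] by (simp add: mult_add_distrib_mat_vec[of _ n n])
  then show ?case using pCons c poly_act_carrier[OF c]
    by (intro eq_vecI) (auto simp: poly_act_pCons[OF c] algebra_simps)
qed

lemma poly_act_smult: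
  fixes X :: "'k::field mat"
  assumes c: "X \<in> carrier_mat n n" "v \<in> carrier_vec n"
  shows "poly_act X v (Polynomial.smult a p) = a \<cdot>\<^sub>v poly_act X v p"
proof (induction p)
  case 0
  then show ?case using c by (auto simp: poly_act_0 intro!: eq_vecI)
next
  case (pCons b p)
  have "X *\<^sub>v (a \<cdot>\<^sub>v poly_act X v p) = a \<cdot>\<^sub>v (X *\<^sub>v poly_act X v p)"
    using c poly_act_carrier[OF c] by (simp add: mult_mat_vec[of _ n n])
  then show ?case using pCons c poly_act_carrier[OF c]
    by (intro eq_vecI) (auto simp: poly_act_pCons[OF c] algebra_simps)
qed

text \<open>
  If \<open>Y v = 0\<close>, then \<open>Y X v = X Y v - Y Y v = 0\<close>: the kernel of \<open>Y\<close> is stable under \<open>X\<close>.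
\<close>

lemma poly_act_kernel:
  fixes X Y :: "'k::field mat"
  assumes pair: "jordan_plane_pair n X Y" and v: "v \<in> carrier_vec n" "Y *\<^sub>v v = 0\<^sub>v n"
  shows "Y *\<^sub>v poly_act X v p = 0\<^sub>v n"
proof (induction p)
  case 0
  then show ?case using pair v by (auto simp: poly_act_0 jordan_plane_pair_def scalar_prod_def)
next
  case (pCons c p)
  have XY: "X \<in> carrier_mat n n" "Y \<in> carrier_mat n n" and rel: "X * Y = Y * X + Y * Y"
    using pair by (auto simp: jordan_plane_pair_def)
  let ?w = "poly_act X v p"
  have w: "?w \<in> carrier_vec n" using poly_act_carrier[OF XY(1) v(1)] .
  have z: "A *\<^sub>v 0\<^sub>v n = 0\<^sub>v n" if "A \<in> carrier_mat n n" for A :: "'k mat" 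
    using that by (intro eq_vecI) (auto simp: scalar_prod_def)
  have "X *\<^sub>v (Y *\<^sub>v ?w) = Y *\<^sub>v (X *\<^sub>v ?w) + Y *\<^sub>v (Y *\<^sub>v ?w)"
  proof -
    have "X *\<^sub>v (Y *\<^sub>v ?w) = (Y * X + Y * Y) *\<^sub>v ?w"
      unfolding rel[symmetric] using XY w by simp
    also have "\<dots> = (Y * X) *\<^sub>v ?w + (Y * Y) *\<^sub>v ?w"
      using XY w by (intro add_mult_distrib_mat_vec[of _ n n]) auto
    finally show ?thesis using XY w by simp
  qed
  then have "Y *\<^sub>v (X *\<^sub>v ?w) = 0\<^sub>v n" using pCons XY w by (simp add: z)
  then have "Y *\<^sub>v (c \<cdot>\<^sub>v v + X *\<^sub>v ?w) = 0\<^sub>v n" using XY v w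
    by (subst mult_add_distrib_mat_vec[of _ n n]) (auto simp: mult_mat_vec[of _ n n])
  then show ?case using XY v by (simp add: poly_act_pCons)
qed

text \<open>
  More vectors \<open>X\<^sup>t v\<close> than the dimension allows must be dependent; a dependency is the coefficient
  vector of the polynomial.
\<close>

lemma annihilating_polynomial:
  fixes X :: "'k::field mat"
  assumes c: "X \<in> carrier_mat n n" "v \<in> carrier_vec n"
  obtains p where "p \<noteq> 0" "poly_act X v p = 0\<^sub>v n"
proof -
  define x where "x t = poly_act X v (monom 1 t)" for t
  have x: "x t \<in> carrier_vec n" for t unfolding x_def using poly_act_carrier[OF c] .
  \<comment> \<open>The \<open>n + 1\<close> vectors \<open>X\<^sup>t v\<close>, \<open>t \<le> n\<close>, padded with a zero row.\<close>
  define M where "M = mat (Suc n) (Suc n) (\<lambda>(i, t). if i < n then x t $ i else 0)"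
  have M: "M \<in> carrier_mat (Suc n) (Suc n)" by (simp add: M_def)
  have "det M = 0"
    using M by (subst laplace_expansion_row[OF M, of n]) (auto intro!: sum.neutral simp: M_def)
  then obtain c' where c': "c' \<in> carrier_vec (Suc n)" "c' \<noteq> 0\<^sub>v (Suc n)" "M *\<^sub>v c' = 0\<^sub>v (Suc n)"
    using det_0_iff_vec_prod_zero[OF M] by auto
  define q where "q m = (\<Sum>t<m. monom (c' $ t) t)" for m :: nat
  have q: "poly_act X v (q m) $ i = (\<Sum>t<m. c' $ t * x t $ i)" if "i < n" for i m
  proof (induction m)
    case 0
    then show ?case using c that by (simp add: q_def poly_act_0)
  next
    case (Suc m)
    have "poly_act X v (monom (c' $ m) m) = c' $ m \<cdot>\<^sub>v x m"
      unfolding x_def poly_act_smult[OF c, symmetric] by (simp add: smult_monom)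
    then show ?case using Suc that x[of m] poly_act_carrier[OF c]
      by (auto simp: q_def poly_act_add[OF c])
  qed
  have "poly_act X v (q (Suc n)) = 0\<^sub>v n"
  proof (rule eq_vecI)
    fix i assume "i < dim_vec (0\<^sub>v n :: 'k vec)"
    then have i: "i < n" by simp
    have "(M *\<^sub>v c') $ i = 0" using c' i by simp
    then show "poly_act X v (q (Suc n)) $ i = 0\<^sub>v n $ i"
      using i c'(1) M unfolding q[OF i]
      by (simp add: scalar_prod_def M_def lessThan_atLeast0 mult.commute)
  qed (use poly_act_carrier[OF c] in auto)
  moreover have "q (Suc n) \<noteq> 0"
  proof -
    obtain t where t: "t < Suc n" "c' $ t \<noteq> 0"
      using c' by (metis carrier_vecD eq_vecI index_zero_vec(1) index_zero_vec(2))
    then have "coeff (q (Suc n)) t = c' $ t"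
      by (simp add: q_def coeff_sum del: sum.lessThan_Suc) 
    then show ?thesis using t by auto
  qed
  ultimately show thesis using that by blast
qed

text \<open>
  Start from a nonzero \<open>v\<close> in the kernel of \<open>Y\<close> and a polynomial \<open>p\<close> with \<open>p(X) v = 0\<close>, and split off a
  root \<open>a\<close>, say \<open>p = (x - a) q\<close>. Either \<open>q(X) v = 0\<close>, and \<open>q\<close> has smaller degree, or \<open>q(X) v\<close> is an
  eigenvector of \<open>X\<close>, still in the kernel of \<open>Y\<close>.
\<close>

lemma common_eigenvector:
  fixes X Y :: "'k::{alg_closed_field, field_char_0} mat"
  assumes pair: "jordan_plane_pair n X Y" and n: "n > 0"
  obtains v a where "v \<in> carrier_vec n" "v \<noteq> 0\<^sub>v n" "X *\<^sub>v v = a \<cdot>\<^sub>v v" "Y *\<^sub>v v = 0\<^sub>v n"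
proof -
  have c: "X \<in> carrier_mat n n" "Y \<in> carrier_mat n n"
    using pair by (auto simp: jordan_plane_pair_def)
  obtain v where v: "v \<in> carrier_vec n" "v \<noteq> 0\<^sub>v n" "Y *\<^sub>v v = 0\<^sub>v n"
    using jordan_plane_pair_det[OF pair n] det_0_iff_vec_prod_zero[OF c(2)] by auto
  obtain p where p: "p \<noteq> 0" "poly_act X v p = 0\<^sub>v n"
    using annihilating_polynomial[OF c(1) v(1)] .
  have "\<exists>w a. w \<in> carrier_vec n \<and> w \<noteq> 0\<^sub>v n \<and> X *\<^sub>v w = a \<cdot>\<^sub>v w \<and> Y *\<^sub>v w = 0\<^sub>v n"
    using p
  proof (induction "degree p" arbitrary: p)
    case 0
    then obtain b where b: "p = [:b:]" "b \<noteq> 0" by (metis degree_eq_zeroE pCons_eq_0_iff)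
    have "X *\<^sub>v 0\<^sub>v n = 0\<^sub>v n" using c by (intro eq_vecI) (auto simp: scalar_prod_def)
    then have "b \<cdot>\<^sub>v v = 0\<^sub>v n" using 0 b v c
      by (simp add: poly_act_pCons[OF c(1) v(1)] poly_act_0)
    then have "v = 0\<^sub>v n" using b v(1)
      by (auto intro!: eq_vecI simp: vec_eq_iff)
    then show ?case using v by simp
  next
    case (Suc d)
    then obtain a where "poly p a = 0" using alg_closed_imp_poly_has_root[of p] by auto
    then obtain q where q: "p = [:-a, 1:] * q" by (meson dvdE poly_eq_0_iff_dvd)
    have q0: "q \<noteq> 0" using q Suc.prems by auto
    have dq: "degree q = d" using Suc.hyps(2) q q0 by (simp add: degree_mult_eq del: mult_pCons_left)
    let ?w = "poly_act X v q"
    have w: "?w \<in> carrier_vec n" using poly_act_carrier[OF c(1) v(1)] .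
    show ?case
    proof (cases "?w = 0\<^sub>v n")
      case True
      then show ?thesis using Suc.hyps(1)[of q] q0 dq by auto
    next
      case False
      have p_eq: "p = pCons 0 q + Polynomial.smult (-a) q" by (simp add: q)
      have "0\<^sub>v n = poly_act X v (pCons 0 q) + poly_act X v (Polynomial.smult (-a) q)"
        using Suc.prems(2) unfolding p_eq poly_act_add[OF c(1) v(1)] by simp
      moreover have "poly_act X v (pCons 0 q) = X *\<^sub>v ?w"
        using c v(1) w by (auto simp: poly_act_pCons[OF c(1) v(1)] intro!: eq_vecI)
      ultimately have "0\<^sub>v n = X *\<^sub>v ?w + (-a) \<cdot>\<^sub>v ?w"
        by (simp only: poly_act_smult[OF c(1) v(1)])
      then have "(X *\<^sub>v ?w) $ i + (-a) * ?w $ i = 0" if "i < n" for i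
        using that w c by (metis carrier_vecD index_add_vec(1) index_smult_vec(1) index_zero_vec(1) smult_carrier_vec)
      then have "X *\<^sub>v ?w = a \<cdot>\<^sub>v ?w" using w c by (intro eq_vecI) (auto simp: add_eq_0_iff)
      then show ?thesis using False w poly_act_kernel[OF pair v(1,3)] by auto
    qed
  qed
  then show thesis using that by blast
qed


section \<open>Simultaneous triangular form\<close>

text \<open>
  The other columns of \<open>P\<close> are the unit vectors other than \<open>e\<^sub>k\<close>, where \<open>v\<close> has a nonzero entry in
  position \<open>k\<close>; the transposition \<open>s\<close> of \<open>0\<close> and \<open>k\<close> distributes them over the remaining columns, and
  \<open>Q\<close> is the explicit inverse.
\<close>

lemma extend_to_basis:
  fixes v :: "'k::field vec"
  assumes v: "v \<in> carrier_vec n" "v \<noteq> 0\<^sub>v n"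
  obtains P Q where "P \<in> carrier_mat n n" "Q \<in> carrier_mat n n" "P * Q = 1\<^sub>m n" "Q * P = 1\<^sub>m n" 
    "col P 0 = v"
proof -
  obtain k where k: "k < n" "v $ k \<noteq> 0"
    using v by (metis carrier_vecD eq_vecI index_zero_vec(1) index_zero_vec(2))
  define s where "s i = (if i = 0 then k else if i = k then 0 else i)" for i :: nat
  have s: "s (s i) = i" "s i < n \<longleftrightarrow> i < n" "s i = k \<longleftrightarrow> i = 0" for i
    using k by (auto simp: s_def)
  define P where "P = mat n n (\<lambda>(i, j). if j = 0 then v $ i else if i = s j then 1 else 0)"
  define Q where "Q = mat n n (\<lambda>(i, j). if i = 0 then (if j = k then 1 / v $ k else 0)
     else (if j = s i then 1 else 0) - (if j = k then v $ s i / v $ k else 0))"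
  have c: "P \<in> carrier_mat n n" "Q \<in> carrier_mat n n" by (auto simp: P_def Q_def)
  have "Q * P = 1\<^sub>m n"
  proof (rule eq_matI)
    fix i j assume "i < dim_row (1\<^sub>m n :: 'k mat)" "j < dim_col (1\<^sub>m n :: 'k mat)"
    then have ij: "i < n" "j < n" by auto
    have d: "(\<Sum>l<n. (if l = r then c else 0) * P $$ (l, j)) = c * P $$ (r, j)" if "r < n" for r and c :: 'k
    proof -
      have "(\<Sum>l<n. (if l = r then c else 0) * P $$ (l, j)) = (\<Sum>l<n. if l = r then c * P $$ (l, j) else 0)"
        by (intro sum.cong) auto
      then show ?thesis using that by (simp add: sum.delta')
    qed
    have "(Q * P) $$ (i, j) = (\<Sum>l<n. Q $$ (i, l) * P $$ (l, j))"
      using ij c by (auto simp: scalar_prod_def lessThan_atLeast0)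
    also have "\<dots> = (if i = 0 then P $$ (k, j) / v $ k
        else P $$ (s i, j) - v $ s i / v $ k * P $$ (k, j))"
      using ij d[OF k(1), of "1 / v $ k"] d[of "s i" 1] d[OF k(1), of "v $ s i / v $ k"] s(2)[of i]
      by (simp add: Q_def left_diff_distrib sum_subtractf)
    also have "P $$ (k, j) = (if j = 0 then v $ k else 0)"
      using ij k s(3)[of j] by (auto simp: P_def)
    also have "P $$ (s i, j) = (if j = 0 then v $ s i else if i = j then 1 else 0)"
      using ij s(1)[of i] s(1)[of j] s(2)[of i] by (auto simp: P_def)
    also have "(if i = 0 then (if j = 0 then v $ k else 0) / v $ k
        else (if j = 0 then v $ s i else if i = j then 1 else 0) - v $ s i / v $ k * (if j = 0 then v $ k else 0))
      = (if i = j then 1 else 0)" using k by simp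
    finally show "(Q * P) $$ (i, j) = 1\<^sub>m n $$ (i, j)" using ij by simp
  qed (use c in auto)
  moreover from this have "P * Q = 1\<^sub>m n"
    using mat_mult_left_right_inverse[OF c(2,1)] by simp
  moreover have "col P 0 = v" using v k by (intro eq_vecI) (auto simp: P_def)
  ultimately show thesis using that c by blast
qed

definition similar_pair :: "'k::field mat \<Rightarrow> 'k mat \<Rightarrow> 'k mat \<Rightarrow> 'k mat \<Rightarrow> bool" where
  "similar_pair X Y X' Y' \<longleftrightarrow> (\<exists>P Q. similar_mat_wit X X' P Q \<and> similar_mat_wit Y Y' P Q)"

lemma similar_pair_trans:
  "similar_pair X Y X' Y' \<Longrightarrow> similar_pair X' Y' X'' Y'' \<Longrightarrow> similar_pair X Y X'' Y''"
  unfolding similar_pair_def using similar_mat_wit_trans by blast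

lemma conjugate_mult:
  fixes A B :: "'k::field mat"
  assumes "P \<in> carrier_mat n n" "Q \<in> carrier_mat n n" "P * Q = 1\<^sub>m n"
    "A \<in> carrier_mat n n" "B \<in> carrier_mat n n"
  shows "(Q * A * P) * (Q * B * P) = Q * (A * B) * P"
proof -
  have "(Q * A * P) * (Q * B * P) = Q * A * (P * Q) * (B * P)"
    using assms(1,2,4,5) by (simp add: assoc_mult_mat[of _ n n _ n _ n])
  also have "\<dots> = Q * (A * B) * P"
    using assms by (simp add: assoc_mult_mat[of _ n n _ n _ n])
  finally show ?thesis .
qed

lemma jordan_plane_pair_similar:
  fixes X Y :: "'k::field mat"
  assumes pair: "jordan_plane_pair n X Y" and sim: "similar_pair X Y X' Y'"
  shows "jordan_plane_pair n X' Y'"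
proof -
  have c: "X \<in> carrier_mat n n" "Y \<in> carrier_mat n n" and rel: "X * Y = Y * X + Y * Y"
    using pair by (auto simp: jordan_plane_pair_def)
  obtain P Q where wit: "similar_mat_wit X X' P Q" "similar_mat_wit Y Y' P Q"
    using sim by (auto simp: similar_pair_def)
  note X = similar_mat_witD2[OF c(1) wit(1)] and Y = similar_mat_witD2[OF c(2) wit(2)]
  have s: "P * Q = 1\<^sub>m n" "X' = Q * X * P" "Y' = Q * Y * P"
    "P \<in> carrier_mat n n" "Q \<in> carrier_mat n n"
    using X(1,6,7) similar_mat_witD2(3)[OF X(5) similar_mat_wit_sym[OF wit(1)]]
      similar_mat_witD2(3)[OF Y(5) similar_mat_wit_sym[OF wit(2)]] by simp_all
  have "X' * Y' = Q * (Y * X + Y * Y) * P"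
    unfolding s(2,3) conjugate_mult[OF s(4,5,1) c] rel ..
  also have "\<dots> = Q * (Y * X) * P + Q * (Y * Y) * P"
    using s c by (simp add: mult_add_distrib_mat[of _ n n _ n] add_mult_distrib_mat[of _ n n _ _ n])
  also have "\<dots> = Y' * X' + Y' * Y'"
    unfolding s(2,3) conjugate_mult[OF s(4,5,1) c(2,1)] conjugate_mult[OF s(4,5,1) c(2,2)] ..
  finally show ?thesis using s c by (auto simp: jordan_plane_pair_def)
qed

text \<open>
  The normal form to be reached: \<open>X\<close> is upper triangular, \<open>Y\<close> strictly so, and neither of them connects
  two indices at which \<open>X\<close> has different diagonal entries. It refines the decomposition into generalized
  eigenspaces of \<open>X\<close>, without asking equal eigenvalues to stand next to each other.
\<close>

definition adapted :: "nat \<Rightarrow> 'k::field mat \<Rightarrow> 'k mat \<Rightarrow> bool" where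
  "adapted n X Y \<longleftrightarrow> (\<forall>i<n. \<forall>j<n.
     (X $$ (i, j) \<noteq> 0 \<longrightarrow> i \<le> j \<and> X $$ (i, i) = X $$ (j, j)) \<and>
     (Y $$ (i, j) \<noteq> 0 \<longrightarrow> i < j \<and> X $$ (i, i) = X $$ (j, j)))"

lemma index_mult_sum:
  fixes A B :: "'k::comm_semiring_0 mat"
  assumes "A \<in> carrier_mat n n" "B \<in> carrier_mat n n" "i < n" "j < n"
  shows "(A * B) $$ (i, j) = (\<Sum>l<n. A $$ (i, l) * B $$ (l, j))"
  using assms by (auto simp: scalar_prod_def lessThan_atLeast0)

text \<open>
  Only the first row of \<open>Y\<close> is at stake. Once the first row of \<open>X\<close> is clean, entry \<open>(0, j)\<close> of the relation
  reads \<open>x\<^sub>0 y\<^sub>j = y\<^sub>j x\<^sub>j\<close>, up to terms with \<open>y\<^sub>l\<close> for \<open>l < j\<close> in the class of \<open>j\<close>, where \<open>x\<close> denotes the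
  diagonal of \<open>X\<close> and \<open>y\<close> the first row of \<open>Y\<close>. By induction on \<open>j\<close>, \<open>y\<^sub>j = 0\<close> whenever \<open>x\<^sub>j\<close> differs from
  \<open>x\<^sub>0\<close>.
\<close>

lemma adapted_extend:
  fixes X Y :: "'k::field mat"
  assumes pair: "jordan_plane_pair (Suc m) X Y"
    and col0: "\<And>i. i < m \<Longrightarrow> X $$ (Suc i, 0) = 0" "\<And>i. i \<le> m \<Longrightarrow> Y $$ (i, 0) = 0"
    and X1: "\<And>i j. i < m \<Longrightarrow> j < m \<Longrightarrow> X $$ (Suc i, Suc j) \<noteq> 0 \<Longrightarrow>
       i \<le> j \<and> X $$ (Suc i, Suc i) = X $$ (Suc j, Suc j)"
    and Y1: "\<And>i j. i < m \<Longrightarrow> j < m \<Longrightarrow> Y $$ (Suc i, Suc j) \<noteq> 0 \<Longrightarrow>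
       i < j \<and> X $$ (Suc i, Suc i) = X $$ (Suc j, Suc j)"
    and row0: "\<And>j. j < m \<Longrightarrow> X $$ (0, Suc j) \<noteq> 0 \<Longrightarrow> X $$ (Suc j, Suc j) = X $$ (0, 0)"
  shows "adapted (Suc m) X Y"
proof -
  have c: "X \<in> carrier_mat (Suc m) (Suc m)" "Y \<in> carrier_mat (Suc m) (Suc m)"
    and rel: "X * Y = Y * X + Y * Y"
    using pair by (auto simp: jordan_plane_pair_def)
  let ?d = "\<lambda>i. X $$ (i, i)"
  have row0': "Y $$ (0, Suc j) = 0" if "j < m" "?d (Suc j) \<noteq> ?d 0" for j
    using that
  proof (induction j rule: less_induct)
    case (less j)
    have "(X * Y) $$ (0, Suc j) = (\<Sum>l<Suc m. X $$ (0, l) * Y $$ (l, Suc j))"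
      using less.prems c by (intro index_mult_sum) auto
    also have "\<dots> = ?d 0 * Y $$ (0, Suc j) + (\<Sum>l<m. X $$ (0, Suc l) * Y $$ (Suc l, Suc j))"
      by (subst sum.lessThan_Suc_shift) simp
    also have "(\<Sum>l<m. X $$ (0, Suc l) * Y $$ (Suc l, Suc j)) = 0"
      using less.prems row0 Y1 by (intro sum.neutral) fastforce
    finally have 1: "(X * Y) $$ (0, Suc j) = ?d 0 * Y $$ (0, Suc j)" by simp
    have "(Y * X) $$ (0, Suc j) = (\<Sum>l<Suc m. Y $$ (0, l) * X $$ (l, Suc j))"
      using less.prems c by (intro index_mult_sum) auto
    also have "\<dots> = (\<Sum>l<m. Y $$ (0, Suc l) * X $$ (Suc l, Suc j))"
      by (subst sum.lessThan_Suc_shift) (simp add: col0(2))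
    also have "\<dots> = (\<Sum>l<m. if l = j then Y $$ (0, Suc j) * ?d (Suc j) else 0)"
    proof (intro sum.cong refl)
      fix l assume l: "l \<in> {..<m}"
      show "Y $$ (0, Suc l) * X $$ (Suc l, Suc j) = (if l = j then Y $$ (0, Suc j) * ?d (Suc j) else 0)"
      proof (cases "l = j \<or> X $$ (Suc l, Suc j) = 0")
        case False
        then have "l < j" "?d (Suc l) \<noteq> ?d 0" using X1[of l j] l less.prems by auto
        then show ?thesis using less.IH[of l] l False by simp
      qed auto
    qed
    also have "\<dots> = Y $$ (0, Suc j) * ?d (Suc j)" using less.prems by simp
    finally have 2: "(Y * X) $$ (0, Suc j) = Y $$ (0, Suc j) * ?d (Suc j)" .
    have "(Y * Y) $$ (0, Suc j) = (\<Sum>l<Suc m. Y $$ (0, l) * Y $$ (l, Suc j))"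
      using less.prems c by (intro index_mult_sum) auto
    also have "\<dots> = (\<Sum>l<m. Y $$ (0, Suc l) * Y $$ (Suc l, Suc j))"
      by (subst sum.lessThan_Suc_shift) (simp add: col0(2))
    also have "\<dots> = 0"
    proof (intro sum.neutral ballI)
      fix l assume l: "l \<in> {..<m}"
      show "Y $$ (0, Suc l) * Y $$ (Suc l, Suc j) = 0"
      proof (cases "Y $$ (Suc l, Suc j) = 0")
        case False
        then have "l < j" "?d (Suc l) \<noteq> ?d 0" using Y1[of l j] l less.prems by auto
        then show ?thesis using less.IH[of l] l by simp
      qed auto
    qed
    finally have 3: "(Y * Y) $$ (0, Suc j) = 0" .
    have "?d 0 * Y $$ (0, Suc j) = Y $$ (0, Suc j) * ?d (Suc j)"
      using arg_cong[OF rel, of "\<lambda>M. M $$ (0, Suc j)"] 1 2 3 c less.prems by simp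
    then show ?case using less.prems by (simp add: mult.commute)
  qed
  then have Y0: "Y $$ (0, Suc j) \<noteq> 0 \<Longrightarrow> j < m \<Longrightarrow> ?d 0 = ?d (Suc j)" for j
    by metis
  show ?thesis
    unfolding adapted_def
  proof (intro allI impI)
    fix i j assume "i < Suc m" "j < Suc m"
    then show "(X $$ (i, j) \<noteq> 0 \<longrightarrow> i \<le> j \<and> ?d i = ?d j) \<and> (Y $$ (i, j) \<noteq> 0 \<longrightarrow> i < j \<and> ?d i = ?d j)"
      using col0 X1[of "i - 1" "j - 1"] Y1[of "i - 1" "j - 1"] row0[of "j - 1"] Y0[of "j - 1"]
      by (cases i; cases j) auto
  qed
qed

text \<open>
  Back substitution for the row \<open>w\<close> with \<open>u + w T - a w = 0\<close>, in the columns where the triangular matrix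
  \<open>T\<close> does not have \<open>a\<close> on its diagonal; in the other columns \<open>w\<close> is \<open>0\<close>.
\<close>

fun eliminating_row :: "'k::field \<Rightarrow> (nat \<Rightarrow> 'k) \<Rightarrow> (nat \<Rightarrow> nat \<Rightarrow> 'k) \<Rightarrow> nat \<Rightarrow> 'k" where
  "eliminating_row a u T j = (if T j j = a then 0
     else (u j + (\<Sum>i<j. eliminating_row a u T i * T i j)) / (a - T j j))"

declare eliminating_row.simps [simp del]

lemma eliminating_row_eq:
  assumes "T j j \<noteq> a" "j < m" "\<And>i. i < m \<Longrightarrow> T i j \<noteq> 0 \<Longrightarrow> i \<le> j"
  shows "u j + (\<Sum>i<m. eliminating_row a u T i * T i j) = a * eliminating_row a u T j"
proof -
  let ?w = "eliminating_row a u T"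
  have "(\<Sum>i<m. ?w i * T i j) = (\<Sum>i<Suc j. ?w i * T i j)"
    using assms(1,2) by (intro sum.mono_neutral_right) (auto, meson assms(3) not_less_eq_eq)
  moreover have "(a - T j j) * ?w j = u j + (\<Sum>i<j. ?w i * T i j)"
    using assms by (subst eliminating_row.simps) simp
  ultimately show ?thesis by (simp add: algebra_simps)
qed

text \<open>
  In a basis starting with a common eigenvector the first columns are as simple as possible, and the
  complementary blocks satisfy the relation again.
\<close>

lemma deflate_pair:
  fixes X Y :: "'k::{alg_closed_field, field_char_0} mat"
  assumes pair: "jordan_plane_pair (Suc m) X Y"
  obtains a u y X1 Y1 where
    "u \<in> carrier_mat 1 m" "y \<in> carrier_mat 1 m" "jordan_plane_pair m X1 Y1"
    "similar_pair X Y (four_block_mat (mat 1 1 (\<lambda>_. a)) u (0\<^sub>m m 1) X1)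
       (four_block_mat (0\<^sub>m 1 1) y (0\<^sub>m m 1) Y1)"
proof -
  have c: "X \<in> carrier_mat (Suc m) (Suc m)" "Y \<in> carrier_mat (Suc m) (Suc m)"
    using pair by (auto simp: jordan_plane_pair_def)
  obtain v a where v: "v \<in> carrier_vec (Suc m)" "v \<noteq> 0\<^sub>v (Suc m)"
    "X *\<^sub>v v = a \<cdot>\<^sub>v v" "Y *\<^sub>v v = 0\<^sub>v (Suc m)"
    using common_eigenvector[OF pair] by auto
  obtain P Q where PQ: "P \<in> carrier_mat (Suc m) (Suc m)" "Q \<in> carrier_mat (Suc m) (Suc m)"
    "P * Q = 1\<^sub>m (Suc m)" "Q * P = 1\<^sub>m (Suc m)" "col P 0 = v"
    using extend_to_basis[OF v(1,2)] .
  define X' Y' where "X' = Q * X * P" and "Y' = Q * Y * P"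
  have c': "X' \<in> carrier_mat (Suc m) (Suc m)" "Y' \<in> carrier_mat (Suc m) (Suc m)"
    using c PQ by (auto simp: X'_def Y'_def)
  have "similar_mat_wit X' X Q P" "similar_mat_wit Y' Y Q P"
    using c c' PQ by (auto intro!: similar_mat_witI simp: X'_def Y'_def)
  then have sim: "similar_pair X Y X' Y'"
    by (auto simp: similar_pair_def dest: similar_mat_wit_sym)
  have Qv: "Q *\<^sub>v v = col (1\<^sub>m (Suc m)) 0"
    using PQ by (metis col_mult2 zero_less_Suc)
  have col: "col (Q * A * P) 0 = Q *\<^sub>v (A *\<^sub>v v)" if "A \<in> carrier_mat (Suc m) (Suc m)" for A
  proof -
    have "col (Q * A * P) 0 = (Q * A) *\<^sub>v col P 0"
      using that PQ(1,2) by (intro col_mult2[of _ "Suc m" "Suc m" _ "Suc m"]) auto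
    then show ?thesis using that PQ(2) v(1) unfolding PQ(5) by simp
  qed
  have colX: "col X' 0 = a \<cdot>\<^sub>v (Q *\<^sub>v v)" unfolding X'_def col[OF c(1)] v(3)
    using PQ v(1) by (simp add: mult_mat_vec[of _ "Suc m" "Suc m"])
  have X0: "X' $$ (i, 0) = (if i = 0 then a else 0)" if "i < Suc m" for i
    using that c' arg_cong[OF colX, of "\<lambda>w. w $ i"] unfolding Qv by auto
  have colY: "col Y' 0 = 0\<^sub>v (Suc m)" unfolding Y'_def col[OF c(2)] v(4)
    using PQ by (intro eq_vecI) (auto simp: scalar_prod_def)
  have Y0: "Y' $$ (i, 0) = 0" if "i < Suc m" for i
    using that c' arg_cong[OF colY, of "\<lambda>w. w $ i"] by auto
  define u where "u = mat 1 m (\<lambda>(i, j). X' $$ (0, Suc j))"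
  define y where "y = mat 1 m (\<lambda>(i, j). Y' $$ (0, Suc j))"
  define X1 where "X1 = mat m m (\<lambda>(i, j). X' $$ (Suc i, Suc j))"
  define Y1 where "Y1 = mat m m (\<lambda>(i, j). Y' $$ (Suc i, Suc j))"
  have "X' = four_block_mat (mat 1 1 (\<lambda>_. a)) u (0\<^sub>m m 1) X1"
    using c' X0 by (intro eq_matI) (auto simp: u_def X1_def four_block_mat_def less_Suc_eq_0_disj)
  moreover have "Y' = four_block_mat (0\<^sub>m 1 1) y (0\<^sub>m m 1) Y1"
    using c' Y0 by (intro eq_matI) (auto simp: y_def Y1_def four_block_mat_def less_Suc_eq_0_disj)
  moreover have "jordan_plane_pair m X1 Y1"
  proof -
    have rel: "X' * Y' = Y' * X' + Y' * Y'"
      using jordan_plane_pair_similar[OF pair sim] by (simp add: jordan_plane_pair_def)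
    have c1: "X1 \<in> carrier_mat m m" "Y1 \<in> carrier_mat m m" by (auto simp: X1_def Y1_def)
    have minor: "(A1 * B1) $$ (i, j) = (A * B) $$ (Suc i, Suc j)"
      if "A \<in> carrier_mat (Suc m) (Suc m)" "B \<in> carrier_mat (Suc m) (Suc m)"
        "A1 = mat m m (\<lambda>(i, j). A $$ (Suc i, Suc j))" "B1 = mat m m (\<lambda>(i, j). B $$ (Suc i, Suc j))"
        "i < m" "j < m" "A $$ (Suc i, 0) = 0" for A B A1 B1 :: "'k mat" and i j
    proof -
      have "(A1 * B1) $$ (i, j) = (\<Sum>l<m. A1 $$ (i, l) * B1 $$ (l, j))"
        using that by (intro index_mult_sum) auto
      also have "\<dots> = (\<Sum>l<Suc m. A $$ (Suc i, l) * B $$ (l, Suc j))"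
        by (subst sum.lessThan_Suc_shift) (simp add: that)
      also have "\<dots> = (A * B) $$ (Suc i, Suc j)"
        using that by (intro index_mult_sum[symmetric]) auto
      finally show ?thesis .
    qed
    have "X1 * Y1 = Y1 * X1 + Y1 * Y1"
    proof (rule eq_matI)
      fix i j assume "i < dim_row (Y1 * X1 + Y1 * Y1)" "j < dim_col (Y1 * X1 + Y1 * Y1)"
      then have ij: "i < m" "j < m" using c1 by auto
      show "(X1 * Y1) $$ (i, j) = (Y1 * X1 + Y1 * Y1) $$ (i, j)"
        using ij c1 c' arg_cong[OF rel, of "\<lambda>M. M $$ (Suc i, Suc j)"]
          minor[OF c' X1_def Y1_def ij] minor[OF c'(2,1) Y1_def X1_def ij]
          minor[OF c'(2,2) Y1_def Y1_def ij] X0[of "Suc i"] Y0[of "Suc i"]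
        by (simp del: index_mult_mat(1))
    qed (use c1 in auto)
    then show ?thesis using c1 by (simp add: jordan_plane_pair_def)
  qed
  ultimately show thesis using that[of u y X1 Y1 a] sim by (auto simp: u_def y_def)
qed


lemma shear_similar:
  fixes A :: "'k::field mat"
  assumes c: "A \<in> carrier_mat 1 1" "u \<in> carrier_mat 1 m" "w \<in> carrier_mat 1 m" "T \<in> carrier_mat m m"
  shows "similar_mat_wit (four_block_mat A u (0\<^sub>m m 1) T)
    (four_block_mat A (u + w * T - A * w) (0\<^sub>m m 1) T)
    (four_block_mat (1\<^sub>m 1) (- w) (0\<^sub>m m 1) (1\<^sub>m m)) (four_block_mat (1\<^sub>m 1) w (0\<^sub>m m 1) (1\<^sub>m m))"
    (is "similar_mat_wit ?X ?X' ?P ?Q")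
proof -
  have one: "four_block_mat (1\<^sub>m 1) (0\<^sub>m 1 m) (0\<^sub>m m 1) (1\<^sub>m m) = (1\<^sub>m (1 + m) :: 'k mat)"
    by (simp)
  have z: "- w + w = 0\<^sub>m 1 m" "w + - w = 0\<^sub>m 1 m" using c by auto
  have nz: "- (0\<^sub>m m m) = (0\<^sub>m m m :: 'k mat)" by (intro eq_matI) auto
  have PQ: "?P * ?Q = 1\<^sub>m (1 + m)" "?Q * ?P = 1\<^sub>m (1 + m)"
    unfolding one[symmetric] using c
    by (subst mult_four_block_mat[of _ 1 1 _ m _ m _ _ 1 _ m]; simp add: nz z)+
  have "?P * ?X' = four_block_mat A (u + w * T - A * w + - (w * T)) (0\<^sub>m m 1) T"
    using c by (subst mult_four_block_mat[of _ 1 1 _ m _ m _ _ 1 _ m]) auto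
  also have "u + w * T - A * w + - (w * T) = u - A * w"
    using c by (intro eq_matI) auto
  also have "four_block_mat A (u - A * w) (0\<^sub>m m 1) T * ?Q = four_block_mat A (A * w + (u - A * w)) (0\<^sub>m m 1) T"
    using c by (subst mult_four_block_mat[of _ 1 1 _ m _ m _ _ 1 _ m]) auto
  also have "A * w + (u - A * w) = u"
    using c by (intro eq_matI) auto
  finally show ?thesis using c PQ
    by (intro similar_mat_witI[of _ _ "1 + m"]) auto
qed

text \<open>
  Induction on the size: split off a common eigenvector, put the remaining blocks into adapted form, and
  remove by a shear those entries of the first row of \<open>X\<close> that link different eigenvalues. The relation
  then clears the corresponding entries of \<open>Y\<close>.
\<close>

theorem adapted_form:
  fixes X Y :: "'k::{alg_closed_field, field_char_0} mat"
  assumes "jordan_plane_pair n X Y"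
  shows "\<exists>X' Y'. similar_pair X Y X' Y' \<and> adapted n X' Y'"
  using assms
proof (induction n arbitrary: X Y)
  case 0
  then show ?case
    unfolding adapted_def similar_pair_def jordan_plane_pair_def
    using similar_mat_wit_refl[of X 0] similar_mat_wit_refl[of Y 0] by blast
next
  case (Suc m)
  obtain a u y X1 Y1 where uy: "u \<in> carrier_mat 1 m" "y \<in> carrier_mat 1 m"
    and pair1: "jordan_plane_pair m X1 Y1"
    and sim1: "similar_pair X Y (four_block_mat (mat 1 1 (\<lambda>_. a)) u (0\<^sub>m m 1) X1)
       (four_block_mat (0\<^sub>m 1 1) y (0\<^sub>m m 1) Y1)" (is "similar_pair X Y ?X1 ?Y1")
    using deflate_pair[OF Suc.prems] .
  from Suc.IH[OF pair1] obtain X2 Y2 P Q where wit: "similar_mat_wit X1 X2 P Q" "similar_mat_wit Y1 Y2 P Q"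
    and ad: "adapted m X2 Y2" by (auto simp: similar_pair_def)
  have c1: "X1 \<in> carrier_mat m m" "Y1 \<in> carrier_mat m m" using pair1 by (auto simp: jordan_plane_pair_def)
  note w = similar_mat_witD2[OF c1(1) wit(1)] and w' = similar_mat_witD2[OF c1(2) wit(2)]
  let ?A = "mat 1 1 (\<lambda>_. a)" and ?Z = "0\<^sub>m 1 1 :: 'k mat"
  let ?X2 = "four_block_mat ?A (u * P) (0\<^sub>m m 1) X2"
  let ?Y2 = "four_block_mat ?Z (y * P) (0\<^sub>m m 1) Y2"
  have cancel: "r = 1\<^sub>m 1 * (r * P) * Q" if "r \<in> carrier_mat 1 m" for r
    using that w(1,6,7) by (simp add: assoc_mult_mat[of _ 1 m _ m _ m])
  have sim2: "similar_pair ?X1 ?Y1 ?X2 ?Y2" unfolding similar_pair_def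
    by (intro exI conjI; rule similar_mat_wit_four_block[OF similar_mat_wit_refl[of _ 1] _ cancel])
      (use uy c1 w(5,6) w'(5) wit in auto)
  define f where "f = eliminating_row a (\<lambda>j. (u * P) $$ (0, j)) (\<lambda>i j. X2 $$ (i, j))"
  define r where "r = mat 1 m (\<lambda>(i, j). f j)"
  have r: "r \<in> carrier_mat 1 m" by (simp add: r_def)
  let ?X3 = "four_block_mat ?A (u * P + r * X2 - ?A * r) (0\<^sub>m m 1) X2"
  let ?Y3 = "four_block_mat ?Z (y * P + r * Y2 - ?Z * r) (0\<^sub>m m 1) Y2"
  have sim3: "similar_pair ?X2 ?Y2 ?X3 ?Y3" unfolding similar_pair_def
    by (intro exI conjI; rule shear_similar) (use uy w(5,6) w'(5) r in auto)
  have sim: "similar_pair X Y ?X3 ?Y3"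
    using sim1 sim2 sim3 by (blast intro: similar_pair_trans)
  have "adapted (Suc m) ?X3 ?Y3"
  proof (rule adapted_extend)
    show "jordan_plane_pair (Suc m) ?X3 ?Y3" using jordan_plane_pair_similar[OF Suc.prems sim] .
    show "?X3 $$ (Suc j, Suc j) = ?X3 $$ (0, 0)" if j: "j < m" and nz: "?X3 $$ (0, Suc j) \<noteq> 0" for j
    proof (rule ccontr)
      assume "?X3 $$ (Suc j, Suc j) \<noteq> ?X3 $$ (0, 0)"
      then have d: "X2 $$ (j, j) \<noteq> a" using w(5) j by (simp add: four_block_mat_def)
      have "?X3 $$ (0, Suc j) = (u * P) $$ (0, j) + (\<Sum>i<m. f i * X2 $$ (i, j)) - a * f j"
        using w(5,6) j uy r by (simp add: four_block_mat_def scalar_prod_def r_def lessThan_atLeast0 del: index_mult_mat(1))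
          (simp add: scalar_prod_def lessThan_atLeast0)
      moreover have "(u * P) $$ (0, j) + (\<Sum>i<m. f i * X2 $$ (i, j)) = a * f j"
        unfolding f_def using d j ad by (intro eliminating_row_eq) (auto simp: adapted_def)
      ultimately show False using nz by simp
    qed
    fix i j assume ij: "i < m" "j < m"
    have e: "?X3 $$ (Suc i, Suc j) = X2 $$ (i, j)" "?Y3 $$ (Suc i, Suc j) = Y2 $$ (i, j)"
      "?X3 $$ (Suc i, Suc i) = X2 $$ (i, i)" "?X3 $$ (Suc j, Suc j) = X2 $$ (j, j)"
      using w(5) w'(5) ij by (auto simp: four_block_mat_def)
    show "i \<le> j \<and> ?X3 $$ (Suc i, Suc i) = ?X3 $$ (Suc j, Suc j)" if "?X3 $$ (Suc i, Suc j) \<noteq> 0"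
      using that ad ij unfolding e adapted_def by blast
    show "i < j \<and> ?X3 $$ (Suc i, Suc i) = ?X3 $$ (Suc j, Suc j)" if "?Y3 $$ (Suc i, Suc j) \<noteq> 0"
      using that ad ij unfolding e adapted_def by blast
  qed (use w(5) w'(5) in \<open>auto simp: four_block_mat_def\<close>)
  then show ?case using sim by blast
qed


section \<open>The numerical bound\<close>

text \<open>
  This is the sum of \<open>min (m + 1) (n - m)\<close> over \<open>m < n\<close>, and also the bound of the theorem for either
  parity of \<open>n\<close>.
\<close>

definition peak :: "nat \<Rightarrow> nat" where
  "peak n = (n + 1)\<^sup>2 div 4"

lemma peak_even: "peak (2 * k) = k * (k + 1)"
proof -
  have "(2 * k + 1)\<^sup>2 = 1 + 4 * (k * (k + 1))" by (simp add: power2_eq_square)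
  then show ?thesis by (simp add: peak_def del: mult_Suc_right)
qed

lemma peak_odd: "peak (2 * k + 1) = (k + 1)\<^sup>2"
proof -
  have "(2 * k + 1 + 1)\<^sup>2 = 4 * (k + 1)\<^sup>2" by (simp add: power2_eq_square)
  then show ?thesis by (simp add: peak_def)
qed

text \<open>
  Passing to a direct sum does not help: different eigenvalues of \<open>X\<close> can be treated separately.
\<close>

lemma peak_superadditive: "peak a + peak b \<le> peak (a + b)"
proof -
  have eo: "peak (2 * k) + peak (2 * l + 1) \<le> peak (2 * k + (2 * l + 1))" for k l
  proof -
    have "peak (2 * k + (2 * l + 1)) = (k + l + 1)\<^sup>2" using peak_odd[of "k + l"] by (simp add: algebra_simps)
    then show ?thesis unfolding peak_even peak_odd by (simp add: power2_eq_square algebra_simps)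
  qed
  consider k l where "a = 2 * k" "b = 2 * l" | k l where "a = 2 * k" "b = 2 * l + 1"
    | k l where "a = 2 * k + 1" "b = 2 * l" | k l where "a = 2 * k + 1" "b = 2 * l + 1"
    by (metis evenE oddE)
  then show ?thesis
  proof cases
    case 1
    then have "peak (a + b) = (k + l) * (k + l + 1)" using peak_even[of "k + l"] by (simp add: algebra_simps)
    then show ?thesis unfolding 1 peak_even by (simp add: algebra_simps)
  next
    case 2
    then show ?thesis using eo by simp
  next
    case 3
    then show ?thesis using eo[of l k] by (simp add: add.commute)
  next
    case 4
    have "peak (a + b) = (k + l + 1) * (k + l + 1 + 1)" using peak_even[of "k + l + 1"] 4
      by (simp add: algebra_simps)
    then show ?thesis unfolding 4 peak_odd by (simp add: algebra_simps power2_eq_square)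
  qed
qed

lemma peak_sum_le:
  assumes "finite I"
  shows "(\<Sum>i\<in>I. peak (f i)) \<le> peak (\<Sum>i\<in>I. f i)"
  using assms
proof (induction I)
  case empty
  then show ?case by simp
next
  case (insert i I)
  then show ?case using peak_superadditive[of "f i" "\<Sum>i\<in>I. f i"] by simp
qed

definition triangle :: "nat \<Rightarrow> (nat \<times> nat) set" where
  "triangle k = {(a, b). a + b < k}"

lemma finite_triangle: "finite (triangle k)"
  by (rule finite_subset[of _ "{..<k} \<times> {..<k}"]) (auto simp: triangle_def)

lemma card_triangle: "2 * card (triangle k) = k * (k + 1)"
proof (induction k)
  case 0
  then show ?case by (simp add: triangle_def)
next
  case (Suc k)
  have "triangle (Suc k) = triangle k \<union> (\<lambda>a. (a, k - a)) ` {..k}"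
    by (auto simp: triangle_def image_iff)
  moreover have "triangle k \<inter> (\<lambda>a. (a, k - a)) ` {..k} = {}"
    by (auto simp: triangle_def)
  moreover have "card ((\<lambda>a. (a, k - a)) ` {..k}) = Suc k"
    by (subst card_image) (auto simp: inj_on_def)
  ultimately have "card (triangle (Suc k)) = card (triangle k) + Suc k"
    using finite_triangle by (simp add: card_Un_disjoint)
  then show ?case using Suc by simp
qed

text \<open>
  The optimal cut: the first triangle counts the monomials \<open>Y\<^sup>a N\<^sup>b\<close> with \<open>a + b < N div 2\<close>, the second
  one the matrix positions that lie at least \<open>N div 2\<close> above the diagonal.
\<close>

lemma card_triangle_halves: "card (triangle (N div 2)) + card (triangle (N - N div 2)) = peak N"
proof (cases "even N")
  case True
  then obtain k where k: "N = 2 * k" by (elim evenE)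
  then show ?thesis using card_triangle[of k] by (simp add: peak_even)
next
  case False
  then obtain k where k: "N = 2 * k + 1" by (elim oddE)
  then have "N div 2 = k" "N - N div 2 = k + 1" by auto
  then show ?thesis using card_triangle[of k] card_triangle[of "k + 1"] k peak_odd[of k]
    by (simp add: power2_eq_square)
qed


section \<open>Spanning sets for the generated algebra\<close>

definition mat_subspace :: "nat \<Rightarrow> 'k::field mat set \<Rightarrow> bool" where
  "mat_subspace n U \<longleftrightarrow> U \<subseteq> carrier_mat n n \<and> 0\<^sub>m n n \<in> U \<and>
     (\<forall>A\<in>U. \<forall>B\<in>U. A + B \<in> U) \<and> (\<forall>c. \<forall>A\<in>U. c \<cdot>\<^sub>m A \<in> U)"

definition mat_unit :: "nat \<Rightarrow> nat \<Rightarrow> nat \<Rightarrow> 'k::field mat" where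
  "mat_unit n i j = mat n n (\<lambda>p. if p = (i, j) then 1 else 0)"

lemma mat_subspace_units:
  fixes T :: "'k::field mat"
  assumes U: "mat_subspace n U" and T: "T \<in> carrier_mat n n"
    and units: "\<And>i j. i < n \<Longrightarrow> j < n \<Longrightarrow> T $$ (i, j) \<noteq> 0 \<Longrightarrow> mat_unit n i j \<in> U"
  shows "T \<in> U"
proof -
  have "mat n n (\<lambda>p. if p \<in> F then T $$ p else 0) \<in> U" if "finite F" "F \<subseteq> {..<n} \<times> {..<n}" for F
    using that
  proof (induction F)
    case empty
    have "mat n n (\<lambda>p. if p \<in> {} then T $$ p else 0) = 0\<^sub>m n n" by (intro eq_matI) auto
    then show ?case using U by (simp add: mat_subspace_def)
  next
    case (insert q F)
    obtain i j where q: "q = (i, j)" "i < n" "j < n" using insert.prems by auto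
    let ?A = "mat n n (\<lambda>p. if p \<in> F then T $$ p else 0)"
    have IH: "?A \<in> U" using insert by auto
    show ?case
    proof (cases "T $$ q = 0")
      case True
      have "mat n n (\<lambda>p. if p \<in> insert q F then T $$ p else 0) = ?A"
        using True by (intro eq_matI) auto
      then show ?thesis using IH by simp
    next
      case False
      have "mat n n (\<lambda>p. if p \<in> insert q F then T $$ p else 0) = ?A + T $$ q \<cdot>\<^sub>m mat_unit n i j"
        using q insert.hyps by (intro eq_matI) (auto simp: mat_unit_def)
      then show ?thesis using IH U units[of i j] False q by (simp add: mat_subspace_def)
    qed
  qed
  from this[of "{..<n} \<times> {..<n}"] have "mat n n (\<lambda>p. if p \<in> {..<n} \<times> {..<n} then T $$ p else 0) \<in> U"
    by simp
  also have "mat n n (\<lambda>p. if p \<in> {..<n} \<times> {..<n} then T $$ p else 0) = T"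
    using T by (intro eq_matI) auto
  finally show ?thesis .
qed

fun letter_mat :: "'k::field mat \<Rightarrow> 'k mat \<Rightarrow> letter \<Rightarrow> 'k mat" where
  "letter_mat X Y LX = X"
| "letter_mat X Y LY = Y"

primrec word_mat :: "nat \<Rightarrow> 'k::field mat \<Rightarrow> 'k mat \<Rightarrow> letter list \<Rightarrow> 'k mat" where
  "word_mat n X Y [] = 1\<^sub>m n"
| "word_mat n X Y (l # w) = letter_mat X Y l * word_mat n X Y w"

text \<open>
  The position of \<open>i\<close> among the indices with the same value of \<open>d\<close>; degrees are measured by differences of
  these ranks, so that each eigenvalue is handled as if its indices were consecutive.
\<close>

definition ev_rank :: "(nat \<Rightarrow> 'k) \<Rightarrow> nat \<Rightarrow> nat" where
  "ev_rank d i = card {l. l < i \<and> d l = d i}"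

lemma ev_rank_less: "i < j \<Longrightarrow> d i = d j \<Longrightarrow> ev_rank d i < ev_rank d j"
  unfolding ev_rank_def by (rule psubset_card_mono) auto

lemma ev_rank_less_card: "i < n \<Longrightarrow> ev_rank d i < card {l. l < n \<and> d l = d i}"
  unfolding ev_rank_def by (rule psubset_card_mono) auto

text \<open>
  The filtration by distance from the diagonal, inside the blocks given by the fibres of \<open>d\<close>.
\<close>

definition band :: "nat \<Rightarrow> (nat \<Rightarrow> 'k) \<Rightarrow> nat \<Rightarrow> 'k::field mat \<Rightarrow> bool" where
  "band n d m T \<longleftrightarrow> T \<in> carrier_mat n n \<and>
     (\<forall>i<n. \<forall>j<n. T $$ (i, j) \<noteq> 0 \<longrightarrow> d i = d j \<and> ev_rank d i + m \<le> ev_rank d j)"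

lemma band_mult:
  fixes A B :: "'k::field mat"
  assumes "band n d a A" "band n d b B"
  shows "band n d (a + b) (A * B)"
  unfolding band_def
proof (intro conjI allI impI)
  fix i j assume ij: "i < n" "j < n" and nz: "(A * B) $$ (i, j) \<noteq> 0"
  have c: "A \<in> carrier_mat n n" "B \<in> carrier_mat n n" using assms by (auto simp: band_def)
  have "(\<Sum>l<n. A $$ (i, l) * B $$ (l, j)) \<noteq> 0" using nz index_mult_sum[OF c ij] by simp
  then obtain l where "l < n" "A $$ (i, l) * B $$ (l, j) \<noteq> 0"
    by (meson lessThan_iff sum.neutral)
  then have l: "l < n" "A $$ (i, l) \<noteq> 0" "B $$ (l, j) \<noteq> 0" by auto
  have "d i = d l \<and> ev_rank d i + a \<le> ev_rank d l" using assms(1) l ij unfolding band_def by blast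
  moreover have "d l = d j \<and> ev_rank d l + b \<le> ev_rank d j" using assms(2) l ij unfolding band_def by blast
  ultimately show "d i = d j" "ev_rank d i + (a + b) \<le> ev_rank d j" by auto
qed (use assms in \<open>auto simp: band_def\<close>)

text \<open>
  Multiplication from the left by the projection onto the coordinates \<open>i\<close> with \<open>d i \<in> L\<close>.
\<close>

definition cut_rows :: "nat \<Rightarrow> (nat \<Rightarrow> 'k) \<Rightarrow> 'k set \<Rightarrow> 'k::field mat \<Rightarrow> 'k mat" where
  "cut_rows n d L A = mat n n (\<lambda>(i, j). if d i \<in> L then A $$ (i, j) else 0)"

lemma cut_rows_carrier [simp]: "cut_rows n d L A \<in> carrier_mat n n"
  by (simp add: cut_rows_def)

lemma mult_cut_rows:
  fixes A T :: "'k::field mat"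
  assumes "band n d m T" "A \<in> carrier_mat n n"
  shows "T * cut_rows n d L A = cut_rows n d L (T * A)"
proof (rule eq_matI)
  fix i j assume "i < dim_row (cut_rows n d L (T * A))" "j < dim_col (cut_rows n d L (T * A))"
  then have ij: "i < n" "j < n" by (auto simp: cut_rows_def)
  have T: "T \<in> carrier_mat n n" using assms by (simp add: band_def)
  have "(T * cut_rows n d L A) $$ (i, j) = (\<Sum>l<n. T $$ (i, l) * (if d l \<in> L then A $$ (l, j) else 0))"
    using index_mult_sum[OF T cut_rows_carrier ij] ij by (simp add: cut_rows_def)
  also have "\<dots> = (\<Sum>l<n. if d i \<in> L then T $$ (i, l) * A $$ (l, j) else 0)"
  proof (intro sum.cong refl)
    fix l assume "l \<in> {..<n}"
    then have "T $$ (i, l) \<noteq> 0 \<Longrightarrow> d i = d l" using assms(1) ij unfolding band_def by blast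
    then show "T $$ (i, l) * (if d l \<in> L then A $$ (l, j) else 0) = (if d i \<in> L then T $$ (i, l) * A $$ (l, j) else 0)"
      by (cases "T $$ (i, l) = 0") auto
  qed
  also have "\<dots> = (if d i \<in> L then (T * A) $$ (i, j) else 0)"
    using index_mult_sum[OF T assms(2) ij] by auto
  finally show "(T * cut_rows n d L A) $$ (i, j) = cut_rows n d L (T * A) $$ (i, j)"
    using ij by (simp add: cut_rows_def)
qed (use assms in \<open>auto simp: band_def cut_rows_def\<close>)

text \<open>
  The linear span, generated inductively so that stability under a multiplication can be checked on
  generators.
\<close>

inductive_set lin_hull :: "nat \<Rightarrow> 'k::field mat set \<Rightarrow> 'k mat set" for n S where
  hull_base: "A \<in> S \<Longrightarrow> A \<in> lin_hull n S"
| hull_zero: "0\<^sub>m n n \<in> lin_hull n S"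
| hull_add: "A \<in> lin_hull n S \<Longrightarrow> B \<in> lin_hull n S \<Longrightarrow> A + B \<in> lin_hull n S"
| hull_smult: "A \<in> lin_hull n S \<Longrightarrow> c \<cdot>\<^sub>m A \<in> lin_hull n S"

lemma lin_hull_least:
  assumes "mat_subspace n U" "S \<subseteq> U"
  shows "lin_hull n S \<subseteq> U"
proof
  fix A assume "A \<in> lin_hull n S"
  then show "A \<in> U" by induction (use assms in \<open>auto simp: mat_subspace_def\<close>)
qed

lemma lin_hull_subspace:
  assumes "S \<subseteq> carrier_mat n n"
  shows "mat_subspace n (lin_hull n S)"
proof -
  have "A \<in> carrier_mat n n" if "A \<in> lin_hull n S" for A
    using that by induction (use assms in auto)
  then show ?thesis unfolding mat_subspace_def by (auto intro: hull_zero hull_add hull_smult)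
qed

lemma lin_hull_mult_left:
  fixes T :: "'k::field mat"
  assumes S: "S \<subseteq> carrier_mat n n" and T: "T \<in> carrier_mat n n"
    and step: "\<And>A. A \<in> S \<Longrightarrow> T * A \<in> lin_hull n S"
    and A: "A \<in> lin_hull n S"
  shows "T * A \<in> lin_hull n S"
  using A
proof induction
  case (hull_base A)
  then show ?case by (rule step)
next
  case hull_zero
  then show ?case using T by (simp add: lin_hull.hull_zero)
next
  case (hull_add A B)
  then have "A \<in> carrier_mat n n" "B \<in> carrier_mat n n"
    using lin_hull_subspace[OF S] by (auto simp: mat_subspace_def)
  then show ?case using hull_add T
    by (simp add: mult_add_distrib_mat[of _ n n] lin_hull.hull_add)
next
  case (hull_smult A c)
  then have "A \<in> carrier_mat n n"
    using lin_hull_subspace[OF S] by (auto simp: mat_subspace_def)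
  then show ?case using hull_smult T
    by (simp add: mult_smult_distrib[of _ n n] lin_hull.hull_smult)
qed

definition normal_monomial :: "nat \<Rightarrow> 'k::field mat \<Rightarrow> 'k mat \<Rightarrow> nat \<Rightarrow> nat \<Rightarrow> 'k mat" where
  "normal_monomial n Y N a b = ((*) Y ^^ a) (((*) N ^^ b) (1\<^sub>m n))"

lemma normal_monomial_carrier:
  assumes "Y \<in> carrier_mat n n" "N \<in> carrier_mat n n"
  shows "normal_monomial n Y N a b \<in> carrier_mat n n"
proof -
  have "((*) N ^^ b) (1\<^sub>m n) \<in> carrier_mat n n" using assms(2) by (induction b) auto
  then show ?thesis unfolding normal_monomial_def using assms(1) by (induction a) auto
qed

lemma normal_monomial_Suc: "normal_monomial n Y N (Suc a) b = Y * normal_monomial n Y N a b"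
  by (simp add: normal_monomial_def)

text \<open>
  The relation gives \<open>N Y\<^sup>a = Y\<^sup>a N + a Y\<^sup>a\<^sup>+\<^sup>1\<close>, so that normally ordered monomials suffice.
\<close>

lemma normal_monomial_mult:
  fixes N Y :: "'k::field mat"
  assumes pair: "jordan_plane_pair n N Y"
  shows "N * normal_monomial n Y N a b =
    normal_monomial n Y N a (Suc b) + of_nat a \<cdot>\<^sub>m normal_monomial n Y N (Suc a) b"
proof (induction a)
  case 0
  have c: "Y \<in> carrier_mat n n" "N \<in> carrier_mat n n" using pair by (auto simp: jordan_plane_pair_def)
  have "0 \<cdot>\<^sub>m normal_monomial n Y N (Suc 0) b = 0\<^sub>m n n"
    using normal_monomial_carrier[OF c, of "Suc 0" b] by (intro eq_matI) auto
  moreover have "N * normal_monomial n Y N 0 b = normal_monomial n Y N 0 (Suc b)"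
    by (simp add: normal_monomial_def)
  ultimately show ?case using normal_monomial_carrier[OF c, of 0 "Suc b"] by simp
next
  case (Suc a)
  have c: "N \<in> carrier_mat n n" "Y \<in> carrier_mat n n" and rel: "N * Y = Y * N + Y * Y"
    using pair by (auto simp: jordan_plane_pair_def)
  let ?W = "normal_monomial n Y N"
  have W: "?W a b \<in> carrier_mat n n" for a b using normal_monomial_carrier[OF c(2,1)] .
  have "N * ?W (Suc a) b = (Y * N + Y * Y) * ?W a b"
    unfolding normal_monomial_Suc rel[symmetric] using c W by (simp add: assoc_mult_mat[of _ n n _ n _ n])
  also have "\<dots> = Y * (N * ?W a b) + Y * (Y * ?W a b)"
    using c W by (simp add: add_mult_distrib_mat[of _ n n _ _ n] assoc_mult_mat[of _ n n _ n _ n])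
  also have "Y * (N * ?W a b) = ?W (Suc a) (Suc b) + of_nat a \<cdot>\<^sub>m ?W (Suc (Suc a)) b"
    unfolding Suc.IH normal_monomial_Suc using c W[of a] W[of "Suc a"]
    by (simp add: mult_add_distrib_mat[of _ n n _ n] mult_smult_distrib[of _ n n _ n])
  also have "Y * (Y * ?W a b) = ?W (Suc (Suc a)) b" by (simp add: normal_monomial_Suc)
  finally show ?case using W[of "Suc a" "Suc b"] W[of "Suc (Suc a)" b]
    by (intro eq_matI) (auto simp: algebra_simps)
qed


text \<open>
  The diagonal of \<open>X\<close> is constant on the blocks, hence commutes with \<open>Y\<close>; removing it does not affect the
  relation.
\<close>

lemma jordan_plane_pair_nilpotent_part:
  fixes X Y :: "'k::field mat"
  assumes pair: "jordan_plane_pair n X Y" and ad: "adapted n X Y"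
    and d_def: "d = (\<lambda>i. X $$ (i, i))"
    and N_def: "N = X - mat n n (\<lambda>(i, j). if i = j then d i else 0)"
  shows "jordan_plane_pair n N Y" "band n d 1 N" "band n d 1 Y" "band n d 0 X"
proof -
  have c: "X \<in> carrier_mat n n" "Y \<in> carrier_mat n n" and rel: "X * Y = Y * X + Y * Y"
    using pair by (auto simp: jordan_plane_pair_def)
  have X: "i \<le> j \<and> d i = d j" if "i < n" "j < n" "X $$ (i, j) \<noteq> 0" for i j
    using that ad unfolding adapted_def d_def by blast
  have Y: "i < j \<and> d i = d j" if "i < n" "j < n" "Y $$ (i, j) \<noteq> 0" for i j
    using that ad unfolding adapted_def d_def by blast
  show "band n d 1 Y" unfolding band_def using c(2) Y ev_rank_less[of _ _ d] by (auto simp: Suc_le_eq)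
  show "band n d 0 X" unfolding band_def using c(1) X ev_rank_less[of _ _ d]
    by (auto simp: le_less)
  let ?D = "mat n n (\<lambda>(i, j). if i = j then d i else 0)"
  have D: "?D \<in> carrier_mat n n" by simp
 have N: "N \<in> carrier_mat n n" unfolding N_def by (rule minus_carrier_mat) simp
  show "band n d 1 N" unfolding band_def
  proof (intro conjI allI impI)
    fix i j assume ij: "i < n" "j < n" "N $$ (i, j) \<noteq> 0"
    then have "i \<noteq> j" "X $$ (i, j) \<noteq> 0" using c by (auto simp: N_def d_def split: if_splits)
    then have "i < j" "d i = d j" using X[of i j] ij by auto
    then show "d i = d j" "ev_rank d i + 1 \<le> ev_rank d j" using ev_rank_less[of i j d] by auto
  qed (rule N)
  have "?D * Y = Y * ?D"
  proof (rule eq_matI)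
    fix i j assume "i < dim_row (Y * ?D)" "j < dim_col (Y * ?D)"
    then have ij: "i < n" "j < n" using c by auto
    have "(?D * Y) $$ (i, j) = (\<Sum>l<n. if l = i then d i * Y $$ (l, j) else 0)"
      unfolding index_mult_sum[OF D c(2) ij] using ij by (intro sum.cong) auto
    also have "\<dots> = d i * Y $$ (i, j)" using ij by simp
    also have "\<dots> = Y $$ (i, j) * d j" using Y[OF ij] by (cases "Y $$ (i, j) = 0") auto
    also have "\<dots> = (\<Sum>l<n. if l = j then Y $$ (i, l) * d j else 0)" using ij by simp
    also have "\<dots> = (Y * ?D) $$ (i, j)"
      unfolding index_mult_sum[OF c(2) D ij] using ij by (intro sum.cong) auto
    finally show "(?D * Y) $$ (i, j) = (Y * ?D) $$ (i, j)" .
  qed (use c in auto)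
  then have "N * Y = Y * X + Y * Y - Y * ?D"
    using c D by (simp add: N_def minus_mult_distrib_mat[of _ n n _ _ n] rel)
  also have "\<dots> = (Y * X - Y * ?D) + Y * Y"
    using c D by (intro eq_matI) (auto simp del: index_mult_mat(1))
  also have "\<dots> = Y * N + Y * Y"
    using c D by (simp add: N_def mult_minus_distrib_mat[of _ n n _ n])
  finally show "jordan_plane_pair n N Y" using c N by (simp add: jordan_plane_pair_def)
qed

text \<open>
  The span of the blocks of all monomials \<open>Y\<^sup>a N\<^sup>b\<close> contains \<open>1\<close> and is stable under left multiplication by
  \<open>X\<close> and \<open>Y\<close>, hence contains all words. A monomial of degree at least \<open>M\<close> is a combination of matrix units
  in the band \<open>M\<close>. The cut-off \<open>M\<close> may be chosen for each eigenvalue.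
\<close>

lemma words_in_subspace:
  fixes X Y :: "'k::field mat"
  assumes pair: "jordan_plane_pair n X Y" and ad: "adapted n X Y"
    and d_def: "d = (\<lambda>i. X $$ (i, i))"
    and N_def: "N = X - mat n n (\<lambda>(i, j). if i = j then d i else 0)"
    and U: "mat_subspace n U"
    and low: "\<And>c a b. c \<in> d ` {..<n} \<Longrightarrow> a + b < M c \<Longrightarrow> cut_rows n d {c} (normal_monomial n Y N a b) \<in> U"
    and high: "\<And>i j. i < n \<Longrightarrow> j < n \<Longrightarrow> d i = d j \<Longrightarrow> ev_rank d i + M (d i) \<le> ev_rank d j \<Longrightarrow> mat_unit n i j \<in> U"
  shows "word_mat n X Y w \<in> U"
proof -
  note np = jordan_plane_pair_nilpotent_part[OF pair ad d_def N_def]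
  have c: "X \<in> carrier_mat n n" "Y \<in> carrier_mat n n" using pair by (auto simp: jordan_plane_pair_def)
  have N: "N \<in> carrier_mat n n" using np(1) by (auto simp: jordan_plane_pair_def)
  let ?W = "normal_monomial n Y N"
  have W: "?W a b \<in> carrier_mat n n" for a b using normal_monomial_carrier[OF c(2) N] .
  have band_one: "band n d 0 (1\<^sub>m n)" by (auto simp: band_def)
  have band_N: "band n d b (((*) N ^^ b) (1\<^sub>m n))" for b
  proof (induction b)
    case (Suc b)
    then show ?case using band_mult[OF np(2)] by fastforce
  qed (simp add: band_one)
  have band_W: "band n d (a + b) (?W a b)" for a b
  proof (induction a)
    case (Suc a)
    then show ?case using band_mult[OF np(3)] by (fastforce simp: normal_monomial_Suc)
  qed (simp add: normal_monomial_def band_N)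
  define S where "S = {cut_rows n d {e} (?W a b) | e a b. True}"
  have S: "S \<subseteq> carrier_mat n n" by (auto simp: S_def)
  have SI: "cut_rows n d {e} (?W a b) \<in> lin_hull n S" for e a b
    by (rule hull_base) (auto simp: S_def)
  have "S \<subseteq> U"
  proof
    fix A assume "A \<in> S"
    then obtain e a b where A: "A = cut_rows n d {e} (?W a b)" by (auto simp: S_def)
    show "A \<in> U"
    proof (cases "e \<in> d ` {..<n} \<and> a + b < M e")
      case True
      then show ?thesis using low A by auto
    next
      case False
      show ?thesis
      proof (rule mat_subspace_units[OF U])
        fix i j assume ij: "i < n" "j < n" "A $$ (i, j) \<noteq> 0"
        then have "d i = e" "?W a b $$ (i, j) \<noteq> 0" by (auto simp: A cut_rows_def split: if_splits)
        moreover from this have "d i = d j \<and> ev_rank d i + (a + b) \<le> ev_rank d j"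
          using band_W ij unfolding band_def by blast
        ultimately show "mat_unit n i j \<in> U" using False ij by (intro high) auto
      qed (simp add: A)
    qed
  qed
  have one: "1\<^sub>m n \<in> lin_hull n S"
  proof -
    have "cut_rows n d L (1\<^sub>m n) \<in> lin_hull n S" if "finite L" for L
      using that
    proof (induction L)
      case empty
      have "cut_rows n d {} (1\<^sub>m n) = 0\<^sub>m n n" by (intro eq_matI) (auto simp: cut_rows_def)
      then show ?case by (simp add: hull_zero)
    next
      case (insert e L)
      have "cut_rows n d (insert e L) (1\<^sub>m n) = cut_rows n d {e} (?W 0 0) + cut_rows n d L (1\<^sub>m n)"
        using insert.hyps by (intro eq_matI) (auto simp: cut_rows_def normal_monomial_def)
      then show ?case using SI insert.IH by (simp add: hull_add)
    qed
    from this[of "d ` {..<n}"] have "cut_rows n d (d ` {..<n}) (1\<^sub>m n) \<in> lin_hull n S" by simp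
    also have "cut_rows n d (d ` {..<n}) (1\<^sub>m n) = 1\<^sub>m n"
      by (intro eq_matI) (auto simp: cut_rows_def)
    finally show ?thesis .
  qed
  have stepY: "Y * A \<in> lin_hull n S" if A: "A \<in> lin_hull n S" for A
  proof (rule lin_hull_mult_left[OF S c(2) _ A])
    fix A assume "A \<in> S"
    then obtain e a b where "A = cut_rows n d {e} (?W a b)" by (auto simp: S_def)
    then have "Y * A = cut_rows n d {e} (?W (Suc a) b)"
      using mult_cut_rows[OF np(3) W] by (simp add: normal_monomial_Suc)
    then show "Y * A \<in> lin_hull n S" using SI by simp
  qed
  \<comment> \<open>The diagonal part of \<open>X\<close> acts on the block of \<open>e\<close> as the scalar \<open>e\<close>.\<close>
  have stepX: "X * A \<in> lin_hull n S" if A: "A \<in> lin_hull n S" for A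
  proof (rule lin_hull_mult_left[OF S c(1) _ A])
    fix A assume "A \<in> S"
    then obtain e a b where A: "A = cut_rows n d {e} (?W a b)" by (auto simp: S_def)
    have X_eq: "X = N + mat n n (\<lambda>(i, j). if i = j then d i else 0)" (is "X = N + ?D")
      using c by (intro eq_matI) (auto simp: N_def)
    have "X * A = cut_rows n d {e} (X * ?W a b)"
      unfolding A using mult_cut_rows[OF np(4) W] .
    also have "X * ?W a b = N * ?W a b + ?D * ?W a b"
      by (subst X_eq) (use N W in \<open>simp add: add_mult_distrib_mat[of _ n n _ _ n]\<close>)
    also have "N * ?W a b = ?W a (Suc b) + of_nat a \<cdot>\<^sub>m ?W (Suc a) b"
      by (rule normal_monomial_mult[OF np(1)])
    also have "?D * ?W a b = mat n n (\<lambda>(i, j). d i * ?W a b $$ (i, j))"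
    proof (rule eq_matI)
      fix i j assume "i < dim_row (mat n n (\<lambda>(i, j). d i * ?W a b $$ (i, j)))"
        "j < dim_col (mat n n (\<lambda>(i, j). d i * ?W a b $$ (i, j)))"
      then have ij: "i < n" "j < n" by auto
      have "(?D * ?W a b) $$ (i, j) = (\<Sum>l<n. ?D $$ (i, l) * ?W a b $$ (l, j))"
        using ij W by (intro index_mult_sum) auto
      also have "\<dots> = (\<Sum>l<n. if l = i then d i * ?W a b $$ (l, j) else 0)"
        using ij by (intro sum.cong) auto
      finally show "(?D * ?W a b) $$ (i, j) = mat n n (\<lambda>(i, j). d i * ?W a b $$ (i, j)) $$ (i, j)"
        using ij by simp
    qed (use W[of a b] in auto)
    also have "cut_rows n d {e} (?W a (Suc b) + of_nat a \<cdot>\<^sub>m ?W (Suc a) b + mat n n (\<lambda>(i, j). d i * ?W a b $$ (i, j)))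
      = cut_rows n d {e} (?W a (Suc b)) + of_nat a \<cdot>\<^sub>m cut_rows n d {e} (?W (Suc a) b) + e \<cdot>\<^sub>m A"
      unfolding A using W[of a "Suc b"] W[of "Suc a" b] W[of a b]
      by (intro eq_matI) (auto simp: cut_rows_def)
    finally show "X * A \<in> lin_hull n S" using SI A by (auto intro!: hull_add hull_smult)
  qed
  have "word_mat n X Y w \<in> lin_hull n S"
  proof (induction w)
    case (Cons l w)
    then show ?case using stepX stepY by (cases l) auto
  qed (simp add: one)
  then show ?thesis using lin_hull_least[OF U \<open>S \<subseteq> U\<close>] by auto
qed

text \<open>
  Cut at half the multiplicity \<open>K e\<close> of each eigenvalue \<open>e\<close>. The positions in the band correspond to pairs
  \<open>(p, q)\<close> of ranks with \<open>p + K e div 2 \<le> q < K e\<close>, and counting \<open>q\<close> from the end turns them into a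
  triangle.
\<close>

theorem adapted_spanning_set:
  fixes X Y :: "'k::field mat"
  assumes pair: "jordan_plane_pair n X Y" and ad: "adapted n X Y"
  obtains S where "finite S" "S \<subseteq> carrier_mat n n" "card S \<le> peak n"
    "\<And>U w. mat_subspace n U \<Longrightarrow> S \<subseteq> U \<Longrightarrow> word_mat n X Y w \<in> U"
proof -
  define d where "d = (\<lambda>i. X $$ (i, i))"
  define N where "N = X - mat n n (\<lambda>(i, j). if i = j then d i else 0)"
  define K where "K e = card {l. l < n \<and> d l = e}" for e
  have c: "X \<in> carrier_mat n n" "Y \<in> carrier_mat n n" using pair by (auto simp: jordan_plane_pair_def)
  define pos where "pos e = {(i, j). i < n \<and> j < n \<and> d i = e \<and> d j = e \<and> ev_rank d i + K e div 2 \<le> ev_rank d j}" for e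
  define S where "S e = (\<lambda>(a, b). cut_rows n d {e} (normal_monomial n Y N a b)) ` triangle (K e div 2)
    \<union> (\<lambda>(i, j). mat_unit n i j) ` pos e" for e
  have fin_pos: "finite (pos e)" for e
    by (rule finite_subset[of _ "{..<n} \<times> {..<n}"]) (auto simp: pos_def)
  have card_pos: "card (pos e) \<le> card (triangle (K e - K e div 2))" for e
  proof (rule card_inj_on_le[of "\<lambda>(i, j). (ev_rank d i, K e - Suc (ev_rank d j))"])
    have inj: "i = j" if "d i = e" "d j = e" "ev_rank d i = ev_rank d j" for i j
      using that ev_rank_less[of i j d] ev_rank_less[of j i d] by (metis less_irrefl linorder_less_linear)
    have less: "ev_rank d j < K e" if "j < n" "d j = e" for j
      using ev_rank_less_card[of j n d] that by (simp add: K_def)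
    show "inj_on (\<lambda>(i, j). (ev_rank d i, K e - Suc (ev_rank d j))) (pos e)"
    proof (rule inj_onI, clarify)
      fix i j i' j' assume *: "(i, j) \<in> pos e" "(i', j') \<in> pos e" "ev_rank d i = ev_rank d i'"
        "K e - Suc (ev_rank d j) = K e - Suc (ev_rank d j')"
      then have "ev_rank d j = ev_rank d j'" using less[of j] less[of j'] by (auto simp: pos_def)
      then show "i = i' \<and> j = j'" using * inj[of i i'] inj[of j j'] by (auto simp: pos_def)
    qed
    show "(\<lambda>(i, j). (ev_rank d i, K e - Suc (ev_rank d j))) ` pos e \<subseteq> triangle (K e - K e div 2)"
    proof (clarify)
      fix i j assume "(i, j) \<in> pos e"
      then have "ev_rank d i + K e div 2 \<le> ev_rank d j" "ev_rank d j < K e"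
        using less by (auto simp: pos_def)
      then have "ev_rank d i + (K e - Suc (ev_rank d j)) < K e - K e div 2" by linarith
      then show "(ev_rank d i, K e - Suc (ev_rank d j)) \<in> triangle (K e - K e div 2)"
        by (simp add: triangle_def)
    qed
  qed (rule finite_triangle)
  have card_S: "card (S e) \<le> peak (K e)" for e
  proof -
    have "card (S e) \<le> card (triangle (K e div 2)) + card (pos e)"
      unfolding S_def using finite_triangle fin_pos
      by (intro order_trans[OF card_Un_le] add_mono card_image_le) auto
    then show ?thesis using card_pos[of e] card_triangle_halves[of "K e"] by linarith
  qed
  have "(\<Sum>e\<in>d ` {..<n}. K e) = card (\<Union>e\<in>d ` {..<n}. {l. l < n \<and> d l = e})"
    unfolding K_def by (subst card_UN_disjoint) auto
  also have "(\<Union>e\<in>d ` {..<n}. {l. l < n \<and> d l = e}) = {..<n}" by auto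
  finally have sum_K: "(\<Sum>e\<in>d ` {..<n}. K e) = n" by simp
  show thesis
  proof
    show "finite (\<Union>e\<in>d ` {..<n}. S e)" using finite_triangle fin_pos by (auto simp: S_def)
    show "(\<Union>e\<in>d ` {..<n}. S e) \<subseteq> carrier_mat n n" by (auto simp: S_def mat_unit_def)
    have "card (\<Union>e\<in>d ` {..<n}. S e) \<le> (\<Sum>e\<in>d ` {..<n}. card (S e))"
      by (rule card_UN_le) simp
    also have "\<dots> \<le> (\<Sum>e\<in>d ` {..<n}. peak (K e))" by (intro sum_mono card_S)
    also have "\<dots> \<le> peak n" using peak_sum_le[of "d ` {..<n}" K] sum_K by simp
    finally show "card (\<Union>e\<in>d ` {..<n}. S e) \<le> peak n" .
    fix U w assume U: "mat_subspace n U" and sub: "(\<Union>e\<in>d ` {..<n}. S e) \<subseteq> U"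
    show "word_mat n X Y w \<in> U"
    proof (rule words_in_subspace[OF pair ad d_def N_def U, where M = "\<lambda>e. K e div 2"])
      fix e a b assume e: "e \<in> d ` {..<n}" and "a + b < K e div 2"
      then have "(a, b) \<in> triangle (K e div 2)" by (simp add: triangle_def)
      then have "cut_rows n d {e} (normal_monomial n Y N a b) \<in> S e" by (force simp: S_def)
      then show "cut_rows n d {e} (normal_monomial n Y N a b) \<in> U" using sub e by blast
    next
      fix i j assume ij: "i < n" "j < n" "d i = d j" "ev_rank d i + K (d i) div 2 \<le> ev_rank d j"
      then have "(i, j) \<in> pos (d i)" by (simp add: pos_def)
      then have "mat_unit n i j \<in> S (d i)" by (force simp: S_def)
      then show "mat_unit n i j \<in> U" using sub ij by blast
    qed
  qed
qed


section \<open>Representations and dimensions\<close>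

lemma mat_subspace_subspace:
  assumes "mat_subspace n A"
  shows "subspace class_ring A (module_mat TYPE('k::field) n n)"
proof -
  interpret matrix_vs n n "TYPE('k)" .
  show ?thesis
    using assms module_axioms vectorspace_axioms
    by (auto simp: mat_subspace_def VectorSpace.subspace_def submodule_def matrix_vs_simps)
qed

text \<open>
  The hypothesis on \<open>U\<close> says that \<open>A\<close> lies in the span of \<open>S\<close>; in this form it can be used without
  expanding linear combinations.
\<close>

lemma subspace_fin_dim:
  fixes A S :: "'k::field mat set"
  assumes A: "mat_subspace n A" and S: "finite S" "S \<subseteq> carrier_mat n n"
    and sub: "\<And>U. mat_subspace n U \<Longrightarrow> S \<subseteq> U \<Longrightarrow> A \<subseteq> U"
  defines "W \<equiv> module_mat TYPE('k) n n \<lparr>carrier := A\<rparr>"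
  shows "vectorspace.fin_dim class_ring W" "vectorspace.dim class_ring W \<le> card S"
proof -
  interpret matrix_vs n n "TYPE('k)" .
  have Asub: "subspace class_ring A V" by (rule mat_subspace_subspace[OF A])
  then have Amod: "submodule class_ring A V" by (simp add: VectorSpace.subspace_def)
  interpret W: vectorspace class_ring W unfolding W_def by (rule subspace_is_vs[OF Asub])
  have Ac: "A \<subseteq> carrier_mat n n" using A by (simp add: mat_subspace_def)
  have "submodule class_ring (span S) V" using S by (intro span_is_submodule) auto
  then have "mat_subspace n (span S)"
    by (auto simp: submodule_def mat_subspace_def matrix_vs_simps)
  then have span: "A \<subseteq> span S" using in_own_span[of S] S by (intro sub) auto
  have carr: "carrier W = A" by (simp add: W_def)
  have small: "card B \<le> card S" if B: "finite B" "B \<subseteq> A" "W.lin_indpt B" for B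
  proof -
    have "lin_indpt B" using span_li_not_depend(2)[OF B(2) Amod] B(3) by (simp add: W_def)
    then show ?thesis using replacement[OF B(1) S(1,2)] B(2) span by fastforce
  qed
  have bound: "finite B \<and> card B \<le> card S" if B: "B \<subseteq> carrier W \<and> W.lin_indpt B" for B
  proof (cases "finite B")
    case False
    then obtain C where C: "C \<subseteq> B" "finite C" "card C = Suc (card S)"
      by (meson infinite_arbitrarily_large)
    then have "W.lin_indpt C" using B W.subset_li_is_li by auto
    then show ?thesis using small[of C] C B carr by auto
  qed (use small B carr in auto)
  have "W.lin_indpt {}" unfolding W.lin_dep_def by auto
  then obtain B where B: "finite B" "maximal B (\<lambda>S. S \<subseteq> carrier W \<and> W.lin_indpt S)"
    using maximal_exists[of "\<lambda>S. S \<subseteq> carrier W \<and> W.lin_indpt S" "card S" "{}"] bound by auto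
  then have basis: "W.basis B" by (intro W.max_li_is_basis) auto
  then show "W.fin_dim" using B(1) unfolding W.fin_dim_def W.basis_def by auto
  have "W.dim = card B" by (rule W.dim_basis[OF B(1) basis])
  then show "W.dim \<le> card S" using bound[of B] basis by (auto simp: W.basis_def)
qed

lemma subspace_dim_ge:
  fixes A B :: "'k::field mat set"
  assumes A: "mat_subspace n A" and fd: "vectorspace.fin_dim class_ring (module_mat TYPE('k) n n \<lparr>carrier := A\<rparr>)"
    and B: "finite B" "B \<subseteq> A"
    and li: "\<And>a. (\<And>i j. i < n \<Longrightarrow> j < n \<Longrightarrow> (\<Sum>T\<in>B. a T * T $$ (i, j)) = 0) \<Longrightarrow> \<forall>T\<in>B. a T = 0"
  shows "card B \<le> vectorspace.dim class_ring (module_mat TYPE('k) n n \<lparr>carrier := A\<rparr>)"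
proof -
  interpret matrix_vs n n "TYPE('k)" .
  have Asub: "subspace class_ring A V" by (rule mat_subspace_subspace[OF A])
  then have Amod: "submodule class_ring A V" by (simp add: VectorSpace.subspace_def)
  interpret W: vectorspace class_ring "V\<lparr>carrier := A\<rparr>" by (rule subspace_is_vs[OF Asub])
  have Bc: "B \<subseteq> carrier_mat n n" using A B by (auto simp: mat_subspace_def)
  have entry: "lincomb a C $$ (i, j) = (\<Sum>T\<in>C. a T * T $$ (i, j))"
    if "finite C" "C \<subseteq> carrier_mat n n" "i < n" "j < n" for a C i j
    using that
  proof (induction C)
    case empty
    then show ?case by (simp add: lincomb_def)
  next
    case (insert T C)
    then have "lincomb a (insert T C) = a T \<cdot>\<^sub>m T + lincomb a C"
      by (subst lincomb_insert2) auto
    moreover have "lincomb a C \<in> carrier_mat n n" using insert.prems by (intro lincomb_closed) auto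
    then have "dim_row (lincomb a C) = n" "dim_col (lincomb a C) = n" by auto
    moreover have "dim_row T = n" "dim_col T = n" using insert.prems by auto
    ultimately show ?case using insert by simp
  qed
  have "lin_indpt B"
  proof (rule finite_lin_indpt2)
    fix a assume "lincomb a B = 0\<^sub>m n n"
    then have "(\<Sum>T\<in>B. a T * T $$ (i, j)) = 0" if "i < n" "j < n" for i j
      using entry[OF B(1) Bc that, of a] that by simp
    then show "\<forall>v\<in>B. a v = 0" by (rule li)
  qed (use B Bc in auto)
  then have "W.lin_indpt B" using span_li_not_depend(2)[OF B(2) Amod] by simp
  then show ?thesis using W.li_le_dim(2)[OF fd] B by simp
qed

lemma single_Cons:
  "Poly_Mapping.single (Word (l # w)) (1::'k::field) = gen l * Poly_Mapping.single (Word w) 1"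
  by (simp add: gen_def mult_single)

lemma single_scalar:
  "Poly_Mapping.single w (c::'k::field) = scalar c * Poly_Mapping.single w 1"
  by (simp add: scalar_def mult_single)

lemma free_alg_induct [case_names zero add]:
  assumes "P 0" "\<And>w c p. P p \<Longrightarrow> P (Poly_Mapping.single w c + p)"
  shows "P (p :: 'k::field free_alg)"
proof (induction p rule: Poly_Mapping.update_induct)
  case const
  then show ?case by (rule assms(1))
next
  case (update f a b)
  have "Poly_Mapping.update a b f = Poly_Mapping.single a b + f"
    using update.hyps(1)
    by (intro poly_mapping_eqI) (auto simp: lookup_update lookup_add lookup_single when_def in_keys_iff)
  then show ?case using assms(2) update by simp
qed

lemma carrier_R_alg: "carrier R_alg = range R_class"
  by (auto simp: R_alg_def R_class_def FactRing_def A_RCOSETS_def')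

lemma R_class_hom: "R_class \<in> Ring.ring_hom free_ring R_alg"
  unfolding R_alg_def R_class_def[abs_def] by (rule ideal.rcos_ring_hom[OF rel_ideal_ideal])

lemma R_class_ideal:
  assumes "p \<in> rel_ideal"
  shows "R_class p = (rel_ideal :: 'k::field free_alg set)"
proof -
  interpret ideal "rel_ideal :: 'k free_alg set" free_ring by (rule rel_ideal_ideal)
  show ?thesis unfolding R_class_def by (rule a_rcos_const[OF assms])
qed

text \<open>
  The relation holds because its left-hand side lies in the ideal. The image is characterized as the least
  subspace containing all words, ready to be compared with a spanning set.
\<close>

lemma representation_imp_pair:
  fixes \<rho> :: "'k::field free_alg set \<Rightarrow> 'k mat"
  assumes rep: "representation n \<rho>"
  defines "X \<equiv> \<rho> (R_class (gen LX))" and "Y \<equiv> \<rho> (R_class (gen LY))"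
  shows "jordan_plane_pair n X Y"
    and "mat_subspace n (image_alg \<rho>)"
    and "mat_subspace n U \<Longrightarrow> (\<And>w. word_mat n X Y w \<in> U) \<Longrightarrow> image_alg \<rho> \<subseteq> U"
    and "word_mat n X Y w \<in> image_alg \<rho>"
    and "A \<in> image_alg \<rho> \<Longrightarrow> B \<in> image_alg \<rho> \<Longrightarrow> A * B \<in> image_alg \<rho>"
proof -
  define h where "h p = \<rho> (R_class p)" for p
  have "\<rho> \<circ> R_class \<in> Ring.ring_hom free_ring (ring_mat TYPE('k) n ())"
    using ring_hom_trans[OF R_class_hom] rep by (auto simp: representation_def)
  then have hom: "h \<in> Ring.ring_hom free_ring (ring_mat TYPE('k) n ())"
    by (simp add: h_def[abs_def] comp_def)
  have h_carrier: "h p \<in> carrier_mat n n" for p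
    using ring_hom_closed[OF hom, of p] by (simp add: ring_mat_simps)
  have h_mult: "h (p * q) = h p * h q" for p q
    using ring_hom_mult[OF hom, of p q] by (simp add: ring_mat_simps)
  have h_add: "h (p + q) = h p + h q" for p q
    using ring_hom_add[OF hom, of p q] by (simp add: ring_mat_simps)
  have h_one: "h 1 = 1\<^sub>m n"
    using ring_hom_one[OF hom] by (simp add: ring_mat_simps)
  have h_scalar: "h (scalar c) = c \<cdot>\<^sub>m 1\<^sub>m n" for c
    using rep by (simp add: representation_def h_def)
  have h_zero: "h 0 = 0\<^sub>m n n"
    using h_scalar[of 0] by (simp add: scalar_def) (auto intro!: eq_matI)
  have XY: "X = h (gen LX)" "Y = h (gen LY)" by (simp_all add: X_def Y_def h_def)
  let ?r = "gen LX * gen LY - gen LY * gen LX - gen LY * gen LY :: 'k free_alg"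
  have "?r \<in> rel_ideal"
    unfolding rel_ideal_def by (rule ring.genideal_self'[OF class_ring.ring_axioms]) (simp add: class_ring_simps)
  moreover have "0 \<in> (rel_ideal :: 'k free_alg set)"
    using additive_subgroup.zero_closed[OF ideal.axioms(1)[OF rel_ideal_ideal]] by (simp add: class_ring_simps)
  ultimately have "h ?r = h 0" by (simp add: h_def R_class_ideal)
  then have "h (?r + (gen LY * gen LX + gen LY * gen LY)) = h (gen LY * gen LX + gen LY * gen LY)"
    unfolding h_add[of ?r] by (simp only: h_zero left_add_zero_mat[OF h_carrier])
  moreover have "?r + (gen LY * gen LX + gen LY * gen LY) = gen LX * gen LY" by simp
  ultimately have "X * Y = Y * X + Y * Y" by (simp add: XY h_add h_mult)
  then show pair: "jordan_plane_pair n X Y" using h_carrier by (simp add: jordan_plane_pair_def XY)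
  have image: "image_alg \<rho> = range h"
    by (auto simp: image_alg_def carrier_R_alg h_def)
  show "A \<in> image_alg \<rho> \<Longrightarrow> B \<in> image_alg \<rho> \<Longrightarrow> A * B \<in> image_alg \<rho>"
    by (auto simp: image simp flip: h_mult)
  have h_smult: "h (scalar c * p) = c \<cdot>\<^sub>m h p" for c p
    using h_carrier[of p] by (simp add: h_mult h_scalar mult_smult_assoc_mat[of _ n n])
  show "mat_subspace n (image_alg \<rho>)"
    unfolding mat_subspace_def image using h_carrier
    by (auto simp flip: h_add h_smult h_zero)
  have word: "h (Poly_Mapping.single (Word w) 1) = word_mat n X Y w" for w
  proof (induction w)
    case Nil
    have "Poly_Mapping.single (Word []) (1::'k) = 1" by (simp flip: zero_word_def)
    then show ?case by (simp add: h_one)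
  next
    case (Cons l w)
    then show ?case by (cases l) (simp_all add: single_Cons h_mult XY)
  qed
  then show "word_mat n X Y w \<in> image_alg \<rho>" unfolding image by (metis rangeI)
  show "image_alg \<rho> \<subseteq> U" if U: "mat_subspace n U" and wU: "\<And>w. word_mat n X Y w \<in> U"
  proof -
    have "h p \<in> U" for p
    proof (induction p rule: free_alg_induct)
      case zero
      then show ?case using U by (simp add: h_zero mat_subspace_def)
    next
      case (add w c p)
      have "h (Poly_Mapping.single w c) \<in> U"
        using U wU by (cases w) (subst single_scalar, auto simp: h_smult word mat_subspace_def)
      then show ?case using U add by (simp add: h_add mat_subspace_def)
    qed
    then show ?thesis by (auto simp: image)
  qed
qed

lemma word_mat_similar:
  fixes X Y :: "'k::field mat"
  assumes c: "X' \<in> carrier_mat n n" "Y' \<in> carrier_mat n n" "P \<in> carrier_mat n n" "Q \<in> carrier_mat n n"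
    and PQ: "P * Q = 1\<^sub>m n" "Q * P = 1\<^sub>m n" and "X = P * X' * Q" "Y = P * Y' * Q"
  shows "word_mat n X Y w = P * word_mat n X' Y' w * Q \<and> word_mat n X' Y' w \<in> carrier_mat n n"
proof (induction w)
  case Nil
  then show ?case using c PQ by simp
next
  case (Cons l w)
  have "letter_mat X Y l = P * letter_mat X' Y' l * Q" "letter_mat X' Y' l \<in> carrier_mat n n"
    using assms by (cases l; simp)+
  then show ?case using Cons conjugate_mult[OF c(4,3) PQ(2)] by simp
qed

lemma conjugate_subspace:
  fixes U :: "'k::field mat set"
  assumes U: "mat_subspace n U" and c: "P \<in> carrier_mat n n" "Q \<in> carrier_mat n n"
  shows "mat_subspace n {A \<in> carrier_mat n n. P * A * Q \<in> U}"
proof -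
  have "P * (A + B) * Q = P * A * Q + P * B * Q" if "A \<in> carrier_mat n n" "B \<in> carrier_mat n n" for A B
    using that c by (simp add: mult_add_distrib_mat[of _ n n _ n] add_mult_distrib_mat[of _ n n _ _ n])
  moreover have "P * (x \<cdot>\<^sub>m A) * Q = x \<cdot>\<^sub>m (P * A * Q)" if "A \<in> carrier_mat n n" for A x
    using that c by (simp add: mult_smult_distrib[of _ n n _ n] mult_smult_assoc_mat[of _ n n _ n])
  moreover have "P * 0\<^sub>m n n * Q = 0\<^sub>m n n" using c by simp
  ultimately show ?thesis using U by (auto simp: mat_subspace_def)
qed

theorem image_dim_le:
  fixes \<rho> :: "'k::{alg_closed_field, field_char_0} free_alg set \<Rightarrow> 'k mat"
  assumes rep: "representation n \<rho>"
  shows "vectorspace.fin_dim class_ring (module_mat TYPE('k) n n \<lparr>carrier := image_alg \<rho>\<rparr>)"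
    and "image_dim n \<rho> \<le> peak n"
proof -
  define X Y where "X = \<rho> (R_class (gen LX))" and "Y = \<rho> (R_class (gen LY))"
  note r = representation_imp_pair[OF rep, folded X_def Y_def]
  have cX: "X \<in> carrier_mat n n" and cY: "Y \<in> carrier_mat n n"
    using r(1) by (auto simp: jordan_plane_pair_def)
  obtain X' Y' P Q where wit: "similar_mat_wit X X' P Q" "similar_mat_wit Y Y' P Q"
    and ad: "adapted n X' Y'"
    using adapted_form[OF r(1)] by (auto simp: similar_pair_def)
  then have pair': "jordan_plane_pair n X' Y'"
    using jordan_plane_pair_similar[OF r(1)] by (auto simp: similar_pair_def)
  note sX = similar_mat_witD2[OF cX wit(1)] and sY = similar_mat_witD2[OF cY wit(2)]
  obtain S where S: "finite S" "S \<subseteq> carrier_mat n n" "card S \<le> peak n"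
    "\<And>U w. mat_subspace n U \<Longrightarrow> S \<subseteq> U \<Longrightarrow> word_mat n X' Y' w \<in> U"
    using adapted_spanning_set[OF pair' ad] by blast
  let ?S = "(\<lambda>A. P * A * Q) ` S"
  have S': "finite ?S" "?S \<subseteq> carrier_mat n n" using S(1,2) sX(6,7) by auto
  have "image_alg \<rho> \<subseteq> U" if U: "mat_subspace n U" "?S \<subseteq> U" for U
  proof (rule r(3)[OF U(1)])
    fix w
    let ?U = "{A \<in> carrier_mat n n. P * A * Q \<in> U}"
    have "word_mat n X' Y' w \<in> ?U"
      using U(2) S(2) by (intro S(4) conjugate_subspace[OF U(1) sX(6,7)]) auto
    then show "word_mat n X Y w \<in> U"
      using word_mat_similar[OF sX(5) sY(5) sX(6,7,1,2,3) sY(3)] by simp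
  qed
  note f = subspace_fin_dim[OF r(2) S' this]
  show "vectorspace.fin_dim class_ring (module_mat TYPE('k) n n \<lparr>carrier := image_alg \<rho>\<rparr>)"
    by (rule f(1))
  have "image_dim n \<rho> \<le> card ?S" unfolding image_dim_def by (rule f(2))
  also have "\<dots> \<le> card S" by (rule card_image_le[OF S(1)])
  finally show "image_dim n \<rho> \<le> peak n" using S(3) by simp
qed


section \<open>Representations from matrix pairs\<close>

definition eval_alg :: "nat \<Rightarrow> 'k::field mat \<Rightarrow> 'k mat \<Rightarrow> 'k free_alg \<Rightarrow> 'k mat" where
  "eval_alg n X Y p = mat n n (\<lambda>ij. \<Sum>w\<in>Poly_Mapping.keys p.
     Poly_Mapping.lookup p w * (case w of Word ls \<Rightarrow> word_mat n X Y ls $$ ij))"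

lemma word_mat_carrier:
  assumes "X \<in> carrier_mat n n" "Y \<in> carrier_mat n n"
  shows "word_mat n X Y w \<in> carrier_mat n n"
proof (induction w)
  case (Cons l w)
  then show ?case using assms by (cases l) auto
qed simp

lemma word_mat_append:
  assumes c: "X \<in> carrier_mat n n" "Y \<in> carrier_mat n n"
  shows "word_mat n X Y (u @ w) = word_mat n X Y u * word_mat n X Y w"
proof (induction u)
  case Nil
  then show ?case using left_mult_one_mat[OF word_mat_carrier[OF c]] by simp
next
  case (Cons l u)
  have "letter_mat X Y l \<in> carrier_mat n n" using c by (cases l) auto
  then show ?case using Cons word_mat_carrier[OF c] by (simp add: assoc_mult_mat[of _ n n _ n _ n])
qed

lemma eval_alg_carrier [simp]: "eval_alg n X Y p \<in> carrier_mat n n"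
  by (simp add: eval_alg_def)

lemma eval_alg_add: "eval_alg n X Y (p + q) = eval_alg n X Y p + eval_alg n X Y q"
proof (rule eq_matI)
  fix i j assume "i < dim_row (eval_alg n X Y p + eval_alg n X Y q)" "j < dim_col (eval_alg n X Y p + eval_alg n X Y q)"
  then have ij: "i < n" "j < n" by (auto simp: eval_alg_def)
  define f where "f w = (case w of Word ls \<Rightarrow> word_mat n X Y ls $$ (i, j))" for w
  let ?K = "Poly_Mapping.keys p \<union> Poly_Mapping.keys q"
  have e: "eval_alg n X Y r $$ (i, j) = (\<Sum>w\<in>?K. Poly_Mapping.lookup r w * f w)"
    if "Poly_Mapping.keys r \<subseteq> ?K" for r
    using that ij unfolding eval_alg_def f_def
    by (simp, intro sum.mono_neutral_left) (auto simp: in_keys_iff)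
  show "eval_alg n X Y (p + q) $$ (i, j) = (eval_alg n X Y p + eval_alg n X Y q) $$ (i, j)"
    using e[of "p + q"] e[of p] e[of q] ij Poly_Mapping.keys_add[of p q]
    by (simp add: lookup_add distrib_right sum.distrib carrier_matD[OF eval_alg_carrier])
qed (auto simp: eval_alg_def)

lemma eval_alg_zero: "eval_alg n X Y 0 = 0\<^sub>m n n"
  by (auto simp: eval_alg_def intro!: eq_matI)

lemma eval_alg_single:
  assumes "X \<in> carrier_mat n n" "Y \<in> carrier_mat n n"
  shows "eval_alg n X Y (Poly_Mapping.single (Word w) c) = c \<cdot>\<^sub>m word_mat n X Y w"
  using carrier_matD[OF word_mat_carrier[OF assms, of w]]
  by (intro eq_matI) (auto simp: eval_alg_def)

lemma eval_alg_mult: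
  fixes X Y :: "'k::field mat"
  assumes c: "X \<in> carrier_mat n n" "Y \<in> carrier_mat n n"
  shows "eval_alg n X Y (p * q) = eval_alg n X Y p * eval_alg n X Y q"
proof (induction p rule: free_alg_induct)
  case zero
  then show ?case by (simp add: eval_alg_zero left_mult_zero_mat[OF eval_alg_carrier])
next
  case (add u a p)
  have "eval_alg n X Y (Poly_Mapping.single u a * q) = eval_alg n X Y (Poly_Mapping.single u a) * eval_alg n X Y q"
  proof (induction q rule: free_alg_induct)
    case zero
    then show ?case by (simp add: eval_alg_zero right_mult_zero_mat[OF eval_alg_carrier])
  next
    case (add w b q)
    obtain u' w' where uw: "u = Word u'" "w = Word w'" by (cases u; cases w)
    have "(a * b) \<cdot>\<^sub>m (word_mat n X Y u' * word_mat n X Y w') = (a \<cdot>\<^sub>m word_mat n X Y u') * (b \<cdot>\<^sub>m word_mat n X Y w')"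
      using word_mat_carrier[OF c, of u'] word_mat_carrier[OF c, of w']
      by (simp add: mult_smult_distrib[of _ n n _ n] mult_smult_assoc_mat[of _ n n _ n]) (intro eq_matI; auto)
    then have "eval_alg n X Y (Poly_Mapping.single u a * Poly_Mapping.single w b)
       = eval_alg n X Y (Poly_Mapping.single u a) * eval_alg n X Y (Poly_Mapping.single w b)"
      using word_mat_append[OF c] by (simp add: uw mult_single eval_alg_single[OF c])
    then show ?case using add
      by (simp add: distrib_left eval_alg_add mult_add_distrib_mat[of _ n n _ n])
  qed
  then show ?case using add
    by (simp add: distrib_right eval_alg_add add_mult_distrib_mat[of _ n n _ _ n])
qed

lemma eval_alg_gen:
  assumes "X \<in> carrier_mat n n" "Y \<in> carrier_mat n n"
  shows "eval_alg n X Y (gen l) = letter_mat X Y l"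
  using assms by (cases l) (auto simp: gen_def eval_alg_single)

lemma eval_alg_hom:
  fixes X Y :: "'k::field mat"
  assumes c: "X \<in> carrier_mat n n" "Y \<in> carrier_mat n n"
  shows "eval_alg n X Y \<in> Ring.ring_hom free_ring (ring_mat TYPE('k) n ())"
proof (rule ring_hom_memI)
  have "(1 :: 'k free_alg) = Poly_Mapping.single (Word []) 1" by (simp flip: zero_word_def)
  then show "eval_alg n X Y \<one>\<^bsub>free_ring\<^esub> = \<one>\<^bsub>ring_mat TYPE('k) n ()\<^esub>"
    using eval_alg_single[OF c, of "[]" 1] by (simp add: ring_mat_simps) (auto intro!: eq_matI)
qed (auto simp: ring_mat_simps eval_alg_mult[OF c] eval_alg_add)

text \<open>
  Evaluation at \<open>(X, Y)\<close> kills the relation, hence the ideal, so on a coset it may be computed from any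
  representative.
\<close>

lemma pair_imp_representation:
  fixes X Y :: "'k::field mat"
  assumes pair: "jordan_plane_pair n X Y"
  obtains \<rho> where "representation n \<rho>" "\<rho> (R_class (gen LX)) = X" "\<rho> (R_class (gen LY)) = Y"
proof -
  have c: "X \<in> carrier_mat n n" "Y \<in> carrier_mat n n" and rel: "X * Y = Y * X + Y * Y"
    using pair by (auto simp: jordan_plane_pair_def)
  let ?e = "eval_alg n X Y" and ?M = "ring_mat TYPE('k) n ()"
  interpret M: ring ?M by (rule ring_mat)
  interpret e: ring_hom_ring "free_ring :: 'k free_alg ring" ?M ?e
    by (rule ring_hom_ringI2[OF class_ring.ring_axioms M.ring_axioms eval_alg_hom[OF c]])
  define r :: "'k free_alg" where "r = gen LX * gen LY - gen LY * gen LX - gen LY * gen LY"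
  have "?e r = 0\<^sub>m n n"
  proof -
    have sum: "r + (gen LY * gen LX + gen LY * gen LY) = gen LX * gen LY" by (simp add: r_def)
    have "?e (gen LX * gen LY) = X * Y" "?e (gen LY * gen LX + gen LY * gen LY) = X * Y"
      by (simp_all only: eval_alg_add eval_alg_mult[OF c] eval_alg_gen[OF c] letter_mat.simps rel)
    then have eq: "?e r + X * Y = X * Y"
      using eval_alg_add[of n X Y r "gen LY * gen LX + gen LY * gen LY"] unfolding sum by simp
    show ?thesis
    proof (rule eq_matI)
      fix i j assume "i < dim_row (0\<^sub>m n n :: 'k mat)" "j < dim_col (0\<^sub>m n n :: 'k mat)"
      then show "?e r $$ (i, j) = 0\<^sub>m n n $$ (i, j)"
        using arg_cong[OF eq, of "\<lambda>A. A $$ (i, j)"] c by (simp del: index_mult_mat(1))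
    qed (auto simp: eval_alg_def)
  qed
  have kernel: "a_kernel free_ring ?M ?e = {p. ?e p = 0\<^sub>m n n}"
    unfolding a_kernel_def' ring_mat_simps by auto
  then have "r \<in> a_kernel free_ring ?M ?e" using \<open>?e r = 0\<^sub>m n n\<close> by (simp only: mem_Collect_eq)
  then have ker: "rel_ideal \<subseteq> a_kernel free_ring ?M ?e"
    unfolding rel_ideal_def r_def[symmetric] using e.kernel_is_ideal by (intro ring.genideal_minimal[OF class_ring.ring_axioms]) auto
  have coset: "?e q = ?e p" if q: "q \<in> R_class p" for p q
  proof -
    obtain r where "r \<in> rel_ideal" "q = r + p" using q by (auto simp: R_class_def a_r_coset_def')
    then show ?thesis using ker unfolding kernel by (auto simp: eval_alg_add left_add_zero_mat[OF eval_alg_carrier])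
  qed
  have self: "p \<in> R_class p" for p :: "'k free_alg"
  proof -
    have "0 \<in> (rel_ideal :: 'k free_alg set)"
      using additive_subgroup.zero_closed[OF ideal.axioms(1)[OF rel_ideal_ideal]] by simp
    then show ?thesis by (auto simp: R_class_def a_r_coset_def')
  qed
  define \<rho> where "\<rho> C = ?e (SOME p. p \<in> C)" for C
  have \<rho>: "\<rho> (R_class p) = ?e p" for p
    unfolding \<rho>_def using coset someI[of "\<lambda>q. q \<in> R_class p", OF self] by blast
  have "\<rho> \<in> Ring.ring_hom R_alg ?M"
  proof (rule ring_hom_memI)
    fix x y :: "'k free_alg set"
    assume "x \<in> carrier R_alg" "y \<in> carrier R_alg"
    then obtain p q where pq: "x = R_class p" "y = R_class q" by (auto simp: carrier_R_alg)
    have "x \<otimes>\<^bsub>R_alg\<^esub> y = R_class (p * q)" "x \<oplus>\<^bsub>R_alg\<^esub> y = R_class (p + q)"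
      using ring_hom_mult[OF R_class_hom, of p q] ring_hom_add[OF R_class_hom, of p q] by (simp_all add: pq)
    then show "\<rho> (x \<otimes>\<^bsub>R_alg\<^esub> y) = \<rho> x \<otimes>\<^bsub>?M\<^esub> \<rho> y" "\<rho> (x \<oplus>\<^bsub>R_alg\<^esub> y) = \<rho> x \<oplus>\<^bsub>?M\<^esub> \<rho> y"
      by (simp_all add: \<rho> pq eval_alg_mult[OF c] eval_alg_add ring_mat_simps)
  next
    fix x assume "x \<in> carrier (R_alg :: 'k free_alg set ring)"
    then show "\<rho> x \<in> carrier ?M" by (auto simp: carrier_R_alg \<rho> ring_mat_simps)
  next
    show "\<rho> \<one>\<^bsub>R_alg\<^esub> = \<one>\<^bsub>?M\<^esub>"
    proof -
      have "R_class (1 :: 'k free_alg) = \<one>\<^bsub>R_alg\<^esub>"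
        using ring_hom_one[OF R_class_hom] by simp
      then show ?thesis using ring_hom_one[OF eval_alg_hom[OF c]] \<rho>[of 1] by simp
    qed
  qed
  moreover have "\<rho> (R_class (scalar a)) = a \<cdot>\<^sub>m 1\<^sub>m n" for a
    using eval_alg_single[OF c, of "[]" a] by (simp add: \<rho> scalar_def zero_word_def)
  ultimately have "representation n \<rho>" by (simp add: representation_def)
  then show thesis using that \<rho> eval_alg_gen[OF c] by simp
qed


section \<open>A full Jordan block\<close>

text \<open>
  If \<open>X\<close> has the superdiagonal \<open>a\<^sub>0, a\<^sub>1, \<dots>\<close>, its commutator with the Jordan block has the entries
  \<open>a\<^sub>i - a\<^sub>i\<^sub>+\<^sub>1\<close> on the second superdiagonal, and these have to be \<open>1\<close>.
\<close>

definition jordan_X :: "nat \<Rightarrow> 'k::field mat" where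
  "jordan_X n = mat n n (\<lambda>(i, j). if j = Suc i then - of_nat i else 0)"

text \<open>
  The elements of the image algebra that will serve as a basis. On the \<open>m\<close>-th superdiagonal the entries
  \<open>(0 - i) (1 - i) \<dots> (l - 1 - i)\<close> vanish exactly for \<open>i < l\<close>, which makes the family triangular.
\<close>

definition diagonal_product :: "nat \<Rightarrow> nat \<Rightarrow> nat \<Rightarrow> 'k::field mat" where
  "diagonal_product n m l = mat n n (\<lambda>(i, j). if j = i + m then \<Prod>t<l. of_nat t - of_nat i else 0)"

lemma diagonal_product_mult:
  fixes T :: "'k::field mat"
  assumes "T = mat n n (\<lambda>(i, j). if j = Suc i then f i else 0)" and "i < n" "j < n"
  shows "(diagonal_product n m l * T) $$ (i, j) =
    (if j = i + Suc m then (\<Prod>t<l. of_nat t - of_nat i) * f (i + m) else 0)"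
proof -
  have "(diagonal_product n m l * T) $$ (i, j) =
      (\<Sum>k<n. diagonal_product n m l $$ (i, k) * T $$ (k, j))"
    using assms by (intro index_mult_sum) (auto simp: diagonal_product_def)
  also have "\<dots> = (\<Sum>k<n. if k = i + m then (if j = i + Suc m then (\<Prod>t<l. of_nat t - of_nat i) * f (i + m) else 0) else 0)"
    using assms by (intro sum.cong) (auto simp: diagonal_product_def)
  also have "\<dots> = (if j = i + Suc m then (\<Prod>t<l. of_nat t - of_nat i) * f (i + m) else 0)"
    using assms by auto
  finally show ?thesis .
qed

lemma jordan_pair: "jordan_plane_pair n (jordan_X n) (jordan_block n (0 :: 'k::field))"
proof -
  let ?X = "jordan_X n :: 'k mat" and ?Y = "jordan_block n (0 :: 'k)"
  have c: "?X \<in> carrier_mat n n" "?Y \<in> carrier_mat n n" by (auto simp: jordan_X_def)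
  have prod: "(A * B) $$ (i, j) = (if j = i + 2 then f i * g (Suc i) else 0)"
    if "A = mat n n (\<lambda>(i, j). if j = Suc i then f i else 0)" "B = mat n n (\<lambda>(i, j). if j = Suc i then g i else 0)"
      "i < n" "j < n" for A B :: "'k mat" and f g i j
  proof -
    have "(A * B) $$ (i, j) = (\<Sum>k<n. A $$ (i, k) * B $$ (k, j))"
      using that by (intro index_mult_sum) auto
    also have "\<dots> = (\<Sum>k<n. if k = Suc i then (if j = i + 2 then f i * g (Suc i) else 0) else 0)"
      using that by (intro sum.cong) auto
    finally show ?thesis using that by auto
  qed
  have Y: "?Y = mat n n (\<lambda>(i, j). if j = Suc i then 1 else 0)" by (intro eq_matI) auto
  have "?X * ?Y = ?Y * ?X + ?Y * ?Y"
  proof (rule eq_matI)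
    fix i j assume "i < dim_row (?Y * ?X + ?Y * ?Y)" "j < dim_col (?Y * ?X + ?Y * ?Y)"
    then have "i < n" "j < n" using c by auto
    then show "(?X * ?Y) $$ (i, j) = (?Y * ?X + ?Y * ?Y) $$ (i, j)"
      using c prod[OF jordan_X_def Y] prod[OF Y jordan_X_def] prod[OF Y Y]
      by (simp del: index_mult_mat(1))
  qed (use c in auto)
  then show ?thesis using c by (simp add: jordan_plane_pair_def)
qed

text \<open>
  The factor that raises both \<open>m\<close> and \<open>l\<close> by one is \<open>X + (m + l) Y\<close>: it sends entry \<open>(i, i + m)\<close> to entry
  \<open>(i, i + m + 1)\<close> with the coefficient \<open>- (i + m) + (m + l) = l - i\<close>. The factor \<open>Y\<close> raises \<open>m\<close> alone.
\<close>

lemma diagonal_product_mem: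
  fixes A :: "'k::field mat set"
  assumes A: "mat_subspace n A" "\<And>S T. S \<in> A \<Longrightarrow> T \<in> A \<Longrightarrow> S * T \<in> A"
    and gens: "1\<^sub>m n \<in> A" "jordan_X n \<in> A" "jordan_block n 0 \<in> A"
    and "l \<le> m"
  shows "diagonal_product n m l \<in> A"
  using \<open>l \<le> m\<close>
proof (induction m arbitrary: l)
  case 0
  have "diagonal_product n 0 0 = (1\<^sub>m n :: 'k mat)" by (intro eq_matI) (auto simp: diagonal_product_def)
  then show ?case using 0 gens by simp
next
  case (Suc m)
  show ?case
  proof (cases l)
    case 0
    have "jordan_block n (0::'k) = mat n n (\<lambda>(i, j). if j = Suc i then 1 else 0)"
      by (intro eq_matI) auto
    then have "diagonal_product n (Suc m) 0 = diagonal_product n m 0 * jordan_block n (0 :: 'k)"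
      by (intro eq_matI, subst diagonal_product_mult) (auto simp: diagonal_product_def)
    then show ?thesis using 0 Suc.IH[of 0] A(2) gens(3) by simp
  next
    case (Suc l')
    let ?T = "jordan_X n + of_nat (m + l') \<cdot>\<^sub>m jordan_block n (0 :: 'k)"
    have T: "?T = mat n n (\<lambda>(i, j). if j = Suc i then of_nat (m + l') - of_nat i else 0)"
      by (intro eq_matI) (auto simp: jordan_X_def)
    have "diagonal_product n (Suc m) (Suc l') = diagonal_product n m l' * ?T"
      by (intro eq_matI, subst diagonal_product_mult[OF T]) (auto simp: diagonal_product_def)
    moreover have "?T \<in> A" using A(1) gens(2,3) by (simp add: mat_subspace_def)
    ultimately show ?thesis using Suc Suc.IH[of l'] Suc.prems A(2) by simp
  qed
qed

text \<open>
  For fixed \<open>m\<close> there are \<open>min (m + 1) (n - m)\<close> values of \<open>l\<close>: as many as monomials of degree \<open>m\<close> in two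
  variables, but at most the length of the \<open>m\<close>-th superdiagonal.
\<close>

definition staircase :: "nat \<Rightarrow> (nat \<times> nat) set" where
  "staircase n = {(m, l). l \<le> m \<and> l + m < n}"

lemma finite_staircase: "finite (staircase n)"
  by (rule finite_subset[of _ "{..<n} \<times> {..<n}"]) (auto simp: staircase_def)

lemma card_staircase: "card (staircase n) = peak n"
proof (induction n rule: induct_nat_012)
  case 0
  then show ?case by (simp add: staircase_def peak_def)
next
  case 1
  have "staircase (Suc 0) = {(0, 0)}" by (auto simp: staircase_def)
  then show ?case by (simp add: peak_def power2_eq_square)
next
  case (ge2 n)
  let ?f = "\<lambda>(m, l). (Suc m, Suc l)" and ?B = "(\<lambda>m. (m, 0 :: nat)) ` {..<n + 2}"
  have "staircase (n + 2) = ?f ` staircase n \<union> ?B"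
  proof (intro equalityI subsetI)
    fix x assume x: "x \<in> staircase (n + 2)"
    obtain m l where ml: "x = (m, l)" by (cases x)
    show "x \<in> ?f ` staircase n \<union> ?B"
    proof (cases l)
      case (Suc l')
      then obtain m' where "m = Suc m'" using x ml by (cases m) (auto simp: staircase_def)
      then have "x = ?f (m', l')" "(m', l') \<in> staircase n" using x ml Suc by (auto simp: staircase_def)
      then show ?thesis by blast
    qed (use x ml in \<open>auto simp: staircase_def\<close>)
  qed (auto simp: staircase_def)
  moreover have "?f ` staircase n \<inter> ?B = {}" by auto
  moreover have "card (?f ` staircase n) = card (staircase n)"
    by (intro card_image) (auto simp: inj_on_def)
  moreover have "card ?B = n + 2" by (subst card_image) (auto simp: inj_on_def)
  ultimately have "card (staircase (n + 2)) = peak n + (n + 2)"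
    using finite_staircase ge2(1) by (simp add: card_Un_disjoint)
  moreover have "(n + 2 + 1)\<^sup>2 = (n + 1)\<^sup>2 + (n + 2) * 4" by (simp add: power2_eq_square)
  then have "peak (n + 2) = peak n + (n + 2)" unfolding peak_def by (simp only: div_mult_self1)
  ultimately show ?case by simp
qed

lemma diagonal_product_entry:
  assumes "i + m < n"
  shows "diagonal_product n m' l $$ (i, i + m) = (if m = m' then \<Prod>t<l. of_nat t - of_nat i else 0)"
  using assms by (auto simp: diagonal_product_def)

lemma falling_product_zero_iff:
  "(\<Prod>t<l. of_nat t - of_nat i) = (0 :: 'k::field_char_0) \<longleftrightarrow> i < l"
  by (auto simp: prod_zero_iff)

lemma diagonal_product_inj:
  "inj_on (\<lambda>(m, l). diagonal_product n m l :: 'k::field_char_0 mat) (staircase n)"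
proof (rule inj_onI, clarify)
  fix m l m' l'
  assume "(m, l) \<in> staircase n" "(m', l') \<in> staircase n"
    and eq: "diagonal_product n m l = (diagonal_product n m' l' :: 'k mat)"
  then have b: "l + m < n" "l' + m' < n" by (auto simp: staircase_def)
  have z: "m = m' \<and> l' \<le> l" if "diagonal_product n m l = (diagonal_product n m' l' :: 'k mat)" "l + m < n"
    for m l m' l'
    using arg_cong[OF that(1), of "\<lambda>A. A $$ (l, l + m)"] that(2)
    by (auto simp: diagonal_product_entry falling_product_zero_iff split: if_splits)
      (metis falling_product_zero_iff less_irrefl not_less)+
  show "m = m' \<and> l = l'" using z[OF eq b(1)] z[OF eq[symmetric] b(2)] by auto
qed

text \<open>
  Induction on \<open>l\<close>, reading the linear relation in position \<open>(l, l + m)\<close>: the terms with larger second index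
  vanish there, those with smaller second index have coefficient \<open>0\<close> already.
\<close>

lemma diagonal_product_independent:
  fixes a :: "'k::field_char_0 mat \<Rightarrow> 'k" and n :: nat
  defines "B \<equiv> (\<lambda>(m, l). diagonal_product n m l) ` staircase n"
  assumes zero: "\<And>i j. i < n \<Longrightarrow> j < n \<Longrightarrow> (\<Sum>T\<in>B. a T * T $$ (i, j)) = 0"
  shows "\<forall>T\<in>B. a T = 0"
proof -
  have "a (diagonal_product n m l) = 0" if "(m, l) \<in> staircase n" for m l
    using that
  proof (induction l arbitrary: m rule: less_induct)
    case (less l)
    let ?T = "diagonal_product n m l :: 'k mat"
    have lm: "l + m < n" using less.prems by (simp add: staircase_def)
    have T: "?T \<in> B" using less.prems by (force simp: B_def)
    have "(\<Sum>T\<in>B. a T * T $$ (l, l + m)) = (\<Sum>T\<in>{?T}. a T * T $$ (l, l + m))"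
    proof (rule sum.mono_neutral_right)
      show "\<forall>T\<in>B - {?T}. a T * T $$ (l, l + m) = 0"
      proof
        fix T assume "T \<in> B - {?T}"
        then obtain m' l' where T: "T = diagonal_product n m' l'" "(m', l') \<in> staircase n" "(m', l') \<noteq> (m, l)"
          by (auto simp: B_def)
        show "a T * T $$ (l, l + m) = 0"
        proof (cases "m' = m \<and> l' \<le> l")
          case True
          then show ?thesis using less.IH[of l' m'] T by auto
        next
          case False
          then have "T $$ (l, l + m) = 0"
            unfolding T(1) diagonal_product_entry[OF lm] using falling_product_zero_iff[of l' l, where 'k = 'k] by auto
          then show ?thesis by simp
        qed
      qed
    qed (use T finite_staircase in \<open>auto simp: B_def\<close>)
    then have "a ?T * ?T $$ (l, l + m) = 0" using zero[of l "l + m"] lm by simp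
    moreover have "?T $$ (l, l + m) \<noteq> 0"
      unfolding diagonal_product_entry[OF lm] using falling_product_zero_iff[of l l, where 'k = 'k] by simp
    ultimately show ?case by simp
  qed
  then show ?thesis by (auto simp: B_def)
qed

lemma dim_bound_eq: "dim_bound n = of_nat (peak n)"
proof (cases "even n")
  case True
  then obtain k where k: "n = 2 * k" by (elim evenE)
  then show ?thesis by (simp add: dim_bound_def peak_even)
next
  case False
  then obtain k where k: "n = 2 * k + 1" by (elim oddE)
  then show ?thesis unfolding k peak_odd by (simp add: dim_bound_def power2_eq_square field_simps)
qed

theorem jordan_block_attains:
  assumes n: "n \<ge> 1"
  shows "\<exists>\<rho> :: 'k::{alg_closed_field, field_char_0} free_alg set \<Rightarrow> 'k mat.
    representation n \<rho> \<and> jordan_nf (\<rho> (R_class (gen LY))) [(n, 0)] \<and> image_dim n \<rho> = peak n"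
proof -
  obtain \<rho> :: "'k free_alg set \<Rightarrow> 'k mat" where rep: "representation n \<rho>"
    and X: "\<rho> (R_class (gen LX)) = jordan_X n" and Y: "\<rho> (R_class (gen LY)) = jordan_block n 0"
    using pair_imp_representation[OF jordan_pair] .
  note r = representation_imp_pair[OF rep, unfolded X Y]
  have "jordan_matrix [(n, 0 :: 'k)] = jordan_block n 0"
    unfolding jordan_matrix_def by (intro eq_matI) (auto simp: Let_def)
  then have nf: "jordan_nf (\<rho> (R_class (gen LY))) [(n, 0)]"
    using n similar_mat_refl[of "jordan_block n 0" n] by (simp add: jordan_nf_def Y)
  define B where "B = (\<lambda>(m, l). diagonal_product n m l :: 'k mat) ` staircase n"
  have c: "jordan_X n \<in> (carrier_mat n n :: 'k mat set)" "jordan_block n (0 :: 'k) \<in> carrier_mat n n"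
    by (auto simp: jordan_X_def)
  have BA: "B \<subseteq> image_alg \<rho>"
  proof
    fix T assume "T \<in> B"
    then obtain m l where T: "T = diagonal_product n m l" "l \<le> m" by (auto simp: B_def staircase_def)
    show "T \<in> image_alg \<rho>" unfolding T(1)
      using r(4)[of "[]"] r(4)[of "[LX]"] r(4)[of "[LY]"] right_mult_one_mat[OF c(1)] right_mult_one_mat[OF c(2)] T(2)
      by (intro diagonal_product_mem[OF r(2,5)]) auto
  qed
  have "card B \<le> image_dim n \<rho>" unfolding image_dim_def
  proof (rule subspace_dim_ge[OF r(2) image_dim_le(1)[OF rep] _ BA])
    fix a :: "'k mat \<Rightarrow> 'k"
    assume "\<And>i j. i < n \<Longrightarrow> j < n \<Longrightarrow> (\<Sum>T\<in>B. a T * T $$ (i, j)) = 0"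
    then show "\<forall>T\<in>B. a T = 0" unfolding B_def by (rule diagonal_product_independent)
  qed (auto simp: B_def finite_staircase)
  moreover have "card B = peak n"
    unfolding B_def by (subst card_image[OF diagonal_product_inj]) (rule card_staircase)
  ultimately have "image_dim n \<rho> = peak n" using image_dim_le(2)[OF rep] by simp
  then show ?thesis using rep nf by blast
qed

theorem mainTheorem5:
  fixes n :: nat
  assumes "n \<ge> 1"
  shows "(\<forall>\<rho> :: 'k::{alg_closed_field, field_char_0} free_alg set \<Rightarrow> 'k mat.
            representation n \<rho> \<longrightarrow> of_nat (image_dim n \<rho>) \<le> dim_bound n) \<and>
         (\<exists>\<rho> :: 'k free_alg set \<Rightarrow> 'k mat.
            representation n \<rho> \<and>
            jordan_nf (\<rho> (R_class (gen LY))) [(n, 0)] \<and>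
            of_nat (image_dim n \<rho>) = dim_bound n)"
  using image_dim_le(2) jordan_block_attains[OF assms] unfolding dim_bound_eq by auto

end
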